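(* Let $d\geq 2$, let $C\subset\mathbb{R}^d$ be a smooth convex body and let $\mathcal{F}$ be a family of packing sets in $\mathbb{R}^d$ of limited complexity (an lc-family). Then there exists an $n_0\in\mathbb{N}$, depending on $\mathcal{F}$ and $C$, such that for all $n\geq n_0$ the value $\lambda(C,n)$ is not attained by any packing set in $\mathcal{F}$.
   Context: $\mathbb{R}^d$ is Euclidean $d$-space with inner product $\langle\cdot,\cdot\rangle$ and norm $|\cdot|$; $B^d=\{x\in\mathbb{R}^d: |x|\le 1\}$. A convex body is a compact convex subset of $\mathbb{R}^d$ with nonempty interior; it is smooth if it has a unique supporting hyperplane through each of its boundary points. A packing set is a discrete set $X\subset\mathbb{R}^d$ whose distinct elements $x,x'$ satisfy $|x-x'|\ge 1$; it defines the sphere packing $X+\tfrac12 B^d$. $|X|$ denotes the cardinality of $X$. For a finite packing set $X$ let $\lambda(C,X)=\min\{\lambda>0 : \lambda C\supset t+X+\tfrac12 B^d \text{ for some } t\in\mathbb{R}^d\}$, and for $n\in\mathbb{N}$ let $\lambda(C,n)=\min\{\lambda(C,X): X \text{ is a packing set with } |X|=n\}$ (equivalently, the minimal $\lambda>0$ such that $\lambda C\supset X+\tfrac12B^d$ for some packing set $X$ with $|X|=n$). A packing set $X$ attains $\lambda(C,n)$ if $|X|=n$ and $\lambda(C,X)=\lambda(C,n)$. A family $\mathcal{F}$ of packing sets in $\mathbb{R}^d$ is of limited complexity (an lc-family) if: (i) there exist isometries $\mathcal{I}_X$ of $\mathbb{R}^d$, one for each $X\in\mathcal{F}$, such that the set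 $\{x-y : x,y\in\mathcal{I}_X(X),\ X\in\mathcal{F}\}$ has only finitely many accumulation points in any bounded region; and (ii) there exists a $\varrho>0$ such that for all $X\in\mathcal{F}$ and all $x\in X$, every affine subspace spanned by some elements of $\{y\in X: |x-y|=1\}$ either contains $x$ or has distance to $x$ larger than $\varrho$. *)

theory Defs
  imports "HOL-Analysis.Analysis"
begin

definition convex_body :: "'a::euclidean_space set \<Rightarrow> bool" where
  "convex_body C \<longleftrightarrow> compact C \<and> convex C \<and> interior C \<noteq> {}"

definition supporting_hyperplane_at :: "'a::euclidean_space set \<Rightarrow> 'a \<Rightarrow> 'a set \<Rightarrow> bool" where
  "supporting_hyperplane_at C p H \<longleftrightarrow>
     p \<in> C \<and> p \<in> H \<and> (\<exists>a b. a \<noteq> 0 \<and> H = {x. a \<bullet> x = b} \<and> C \<subseteq> {x. a \<bullet> x \<le> b})"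

definition smooth_convex_body :: "'a::euclidean_space set \<Rightarrow> bool" where
  "smooth_convex_body C \<longleftrightarrow>
     convex_body C \<and> (\<forall>p\<in>frontier C. \<exists>!H. supporting_hyperplane_at C p H)"

definition packing_set :: "'a::euclidean_space set \<Rightarrow> bool" where
  "packing_set X \<longleftrightarrow> discrete X \<and> (\<forall>x\<in>X. \<forall>x'\<in>X. x \<noteq> x' \<longrightarrow> norm (x - x') \<ge> 1)"

definition sphere_packing :: "'a::euclidean_space set \<Rightarrow> 'a set" where
  "sphere_packing X = (\<Union>x\<in>X. cball x (1/2))"

definition lambda_set :: "'a::euclidean_space set \<Rightarrow> 'a set \<Rightarrow> real" where
  "lambda_set C X =
     (LEAST l. l > 0 \<and> (\<exists>t. (+) t ` sphere_packing X \<subseteq> (*\<^sub>R) l ` C))"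

definition lambda_num :: "'a::euclidean_space set \<Rightarrow> nat \<Rightarrow> real" where
  "lambda_num C n =
     (LEAST l. \<exists>X. packing_set X \<and> finite X \<and> card X = n \<and> l = lambda_set C X)"

definition attains_lambda :: "'a::euclidean_space set \<Rightarrow> nat \<Rightarrow> 'a set \<Rightarrow> bool" where
  "attains_lambda C n X \<longleftrightarrow>
     packing_set X \<and> finite X \<and> card X = n \<and> lambda_set C X = lambda_num C n"

text \<open>Surjectivity is automatic in finite dimension.\<close>

definition isometry :: "('a::euclidean_space \<Rightarrow> 'a) \<Rightarrow> bool" where
  "isometry f \<longleftrightarrow> (\<forall>x y. dist (f x) (f y) = dist x y)"

text \<open>In the second condition the spanning set \<open>S\<close> is nonempty: the empty set spans no
  affine subspace, and \<open>infdist x {} = 0\<close> would make the condition fail.\<close>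

definition lc_family :: "'a::euclidean_space set set \<Rightarrow> bool" where
  "lc_family F \<longleftrightarrow>
     (\<forall>X\<in>F. packing_set X) \<and>
     (\<exists>I. (\<forall>X\<in>F. isometry (I X)) \<and>
          (\<forall>R. bounded R \<longrightarrow>
             finite {p\<in>R. p islimpt {x - y | x y X. X \<in> F \<and> x \<in> I X ` X \<and> y \<in> I X ` X}})) \<and>
     (\<exists>\<rho>>0. \<forall>X\<in>F. \<forall>x\<in>X. \<forall>S. S \<noteq> {} \<and> S \<subseteq> {y\<in>X. norm (x - y) = 1} \<longrightarrow>
          x \<in> affine hull S \<or> infdist x (affine hull S) > \<rho>)"

text \<open>The two minima written with \<open>LEAST\<close> exist for nonempty finite packing sets, that is, for
  \<open>n > 0\<close>; for \<open>n = 0\<close> the first one is a minimum over all positive reals, so its value is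
  meaningless.\<close>

lemma min_configuration:
  fixes C :: "'a::euclidean_space set" and K :: "(nat \<Rightarrow> 'a) set"
  assumes C: "convex_body C" and n: "n > 0" and K: "closed K"
    and zero: "\<And>f g. f \<in> K \<Longrightarrow> (\<And>i. i < n \<Longrightarrow> g i = f i) \<Longrightarrow> g \<in> K"
    and ne: "f0 \<in> K" "L > 0" "\<And>i. i < n \<Longrightarrow> cball (f0 i) (1/2) \<subseteq> (*\<^sub>R) L ` C"
  shows "\<exists>l f. f \<in> K \<and> l > 0 \<and> (\<forall>i<n. cball (f i) (1/2) \<subseteq> (*\<^sub>R) l ` C) \<and>
     (\<forall>l' f'. f' \<in> K \<and> l' > 0 \<and> (\<forall>i<n. cball (f' i) (1/2) \<subseteq> (*\<^sub>R) l' ` C) \<longrightarrow> l \<le> l')"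
proof -
  define W where "W = (\<lambda>(l, c). (l, l *\<^sub>R c)) ` ({0..L} \<times> C)"
  have cC: "compact C" using C by (simp add: convex_body_def)
  have "compact W" unfolding W_def
    by (intro compact_continuous_image compact_Times cC)
       (auto simp: case_prod_unfold intro!: continuous_intros)
  then have clW: "closed W" by (rule compact_imp_closed)
  have W_iff: "(l, y) \<in> W \<longleftrightarrow> 0 \<le> l \<and> l \<le> L \<and> y \<in> (*\<^sub>R) l ` C" for l y
    by (auto simp: W_def)
  have "compact (snd ` W)" using \<open>compact W\<close>
    by (intro compact_continuous_image) (auto intro!: continuous_intros)
  then obtain R where R: "\<And>l y. (l, y) \<in> W \<Longrightarrow> y \<in> cball 0 R"
    by (force dest!: compact_imp_bounded simp: bounded_iff image_iff)
  define P where "P = Pi\<^sub>E UNIV (\<lambda>i::nat. if i < n then cball (0::'a) R else {0})"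
  have "compactin (product_topology (\<lambda>i::nat. euclidean::'a topology) UNIV) P"
    unfolding P_def by (subst compactin_PiE) auto
  then have cP: "compact P" by (simp add: euclidean_product_topology)
  define M where "M = ({0..L} \<times> (P \<inter> K)) \<inter>
     (\<Inter>i\<in>{..<n}. \<Inter>u\<in>cball 0 (1/2). {z. (fst z, snd z i + u) \<in> W})"
  have "closed {z::real \<times> (nat \<Rightarrow> 'a). (fst z, snd z i + u) \<in> W}" for i u
  proof -
    have "continuous_on UNIV (\<lambda>z::real \<times> (nat \<Rightarrow> 'a). snd z i)"
      by (rule continuous_on_compose2[OF continuous_on_product_coordinates
          continuous_on_snd[OF continuous_on_id]]) auto
    then have "continuous_on UNIV (\<lambda>z::real \<times> (nat \<Rightarrow> 'a). (fst z, snd z i + u))"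
      by (intro continuous_intros) auto
    from closed_vimage[OF clW this] show ?thesis by (simp add: vimage_def)
  qed
  then have cM: "compact M" unfolding M_def
    by (intro compact_Int_closed compact_Times closed_INT ballI cP K) auto
  have M_I: "\<exists>g. (l, g) \<in> M \<and> g \<in> K \<and> (\<forall>i<n. g i = f i)"
    if "f \<in> K" "0 < l" "l \<le> L" "\<And>i. i < n \<Longrightarrow> cball (f i) (1/2) \<subseteq> (*\<^sub>R) l ` C" for l f
  proof -
    define g where "g i = (if i < n then f i else 0)" for i
    have gK: "g \<in> K" by (rule zero[OF that(1)]) (simp add: g_def)
    have w: "(l, f i + u) \<in> W" if "i < n" "norm u \<le> 1/2" for i u
    proof -
      have "f i + u \<in> cball (f i) (1/2)" using that by (simp add: dist_norm)
      then have "f i + u \<in> (*\<^sub>R) l ` C"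
        using \<open>\<And>i. i < n \<Longrightarrow> cball (f i) (1/2) \<subseteq> (*\<^sub>R) l ` C\<close> \<open>i < n\<close> by blast
      with \<open>0 < l\<close> \<open>l \<le> L\<close> show ?thesis unfolding W_iff by simp
    qed
    have "f i \<in> cball 0 R" if "i < n" for i using R[OF w[OF that, of 0]] by simp
    then have "g \<in> P" by (auto simp: P_def g_def)
    have "(l, g i + u) \<in> W" if "i < n" "u \<in> cball 0 (1/2)" for i u
      using w[of i u] that by (simp add: g_def)
    with gK \<open>g \<in> P\<close> \<open>0 < l\<close> \<open>l \<le> L\<close> have "(l, g) \<in> M" unfolding M_def by simp
    then show ?thesis using gK by (intro exI[of _ g]) (simp add: g_def)
  qed
  have M_D: "l > 0 \<and> f \<in> K \<and> (\<forall>i<n. cball (f i) (1/2) \<subseteq> (*\<^sub>R) l ` C)" if "(l, f) \<in> M" for l f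
  proof -
    have sub: "cball (f i) (1/2) \<subseteq> (*\<^sub>R) l ` C" if "i < n" for i
    proof
      fix y assume "y \<in> cball (f i) (1/2)"
      then have "y - f i \<in> cball 0 (1/2)" by (simp add: dist_norm norm_minus_commute)
      moreover have "\<forall>u\<in>cball 0 (1/2). (l, f i + u) \<in> W"
        using \<open>(l, f) \<in> M\<close> \<open>i < n\<close> unfolding M_def by simp
      ultimately have "(l, f i + (y - f i)) \<in> W" by blast
      then show "y \<in> (*\<^sub>R) l ` C" by (simp add: W_iff)
    qed
    have "l \<noteq> 0"
    proof
      assume "l = 0"
      then have *: "cball (f 0) (1/2) \<subseteq> {0}" using sub[OF n] by auto
      obtain b :: 'a where b: "b \<in> Basis" using nonempty_Basis by blast
      have "f 0 \<in> cball (f 0) (1/2)" "f 0 + (1/2) *\<^sub>R b \<in> cball (f 0) (1/2)"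
        using b by (auto simp: dist_norm)
      with * have "f 0 = 0" "f 0 + (1/2) *\<^sub>R b = 0" by blast+
      with b show False by auto
    qed
    moreover have "0 \<le> l" "f \<in> K" using \<open>(l, f) \<in> M\<close> unfolding M_def by simp_all
    ultimately show ?thesis using sub by simp
  qed
  have "M \<noteq> {}" using M_I[of f0 L] ne by auto
  have "continuous_on M fst" by (intro continuous_intros)
  from continuous_attains_inf[OF cM \<open>M \<noteq> {}\<close> this]
  obtain z where z: "z \<in> M" "\<forall>y\<in>M. fst z \<le> fst y" by blast
  obtain l f where "z = (l, f)" by (cases z)
  with z have lf: "(l, f) \<in> M" and min: "\<And>l' f'. (l', f') \<in> M \<Longrightarrow> l \<le> l'" by fastforce+
  have "l \<le> l'" if "f' \<in> K" "l' > 0" "\<forall>i<n. cball (f' i) (1/2) \<subseteq> (*\<^sub>R) l' ` C" for l' f'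
  proof (cases "l' \<le> L")
    case True
    with M_I[of f' l'] that obtain g where "(l', g) \<in> M" by blast
    then show ?thesis by (rule min)
  next
    case False
    have "l \<le> L" using lf unfolding M_def by simp
    with False show ?thesis by simp
  qed
  with M_D[OF lf] show ?thesis by blast
qed

lemma bounded_in_scaled_body:
  fixes C :: "'a::euclidean_space set"
  assumes C: "convex_body C" and B: "bounded B"
  shows "\<exists>l>0. \<exists>t. (+) t ` B \<subseteq> (*\<^sub>R) l ` C"
proof -
  obtain c e where e: "e > 0" "cball c e \<subseteq> C"
    using C unfolding convex_body_def by (meson ex_in_conv mem_interior_cball)
  obtain r where r: "r > 0" "\<And>x. x \<in> B \<Longrightarrow> norm x \<le> r"
    using B bounded_pos by blast
  define l where "l = r / e"
  have l: "l > 0" using e r by (simp add: l_def)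
  have "(+) (l *\<^sub>R c) ` B \<subseteq> (*\<^sub>R) l ` C"
  proof
    fix y assume "y \<in> (+) (l *\<^sub>R c) ` B"
    then obtain x where x: "x \<in> B" "y = l *\<^sub>R c + x" by auto
    have "norm ((1 / l) *\<^sub>R x) \<le> e" using r(2)[OF x(1)] e r(1)
      by (simp add: l_def field_simps)
    then have "c + (1 / l) *\<^sub>R x \<in> C" using e by (auto simp: dist_norm)
    moreover have "y = l *\<^sub>R (c + (1 / l) *\<^sub>R x)" using l x by (simp add: algebra_simps)
    ultimately show "y \<in> (*\<^sub>R) l ` C" by blast
  qed
  with l show ?thesis by blast
qed

lemma sphere_packing_translate_iff:
  "(+) t ` sphere_packing X \<subseteq> S \<longleftrightarrow> (\<forall>x\<in>X. cball (t + x) (1/2) \<subseteq> S)"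
proof -
  have "(+) t ` sphere_packing X = (\<Union>x\<in>X. cball (t + x) (1/2))"
    by (simp only: sphere_packing_def image_UN cball_translation)
  then show ?thesis by (simp only: UN_subset_iff)
qed

lemma bounded_sphere_packing: "finite X \<Longrightarrow> bounded (sphere_packing X)"
  by (auto simp: sphere_packing_def)

lemma LEAST_real_min:
  fixes P :: "real \<Rightarrow> bool"
  assumes "P l" "\<And>l'. P l' \<Longrightarrow> l \<le> l'"
  shows "P (LEAST l. P l)" "\<And>l'. P l' \<Longrightarrow> (LEAST l. P l) \<le> l'"
  using Least_equality[of P l] assms by auto

lemma lambda_set_is_min:
  fixes C X :: "'a::euclidean_space set"
  assumes C: "convex_body C" and X: "finite X" "X \<noteq> {}"
  shows "lambda_set C X > 0 \<and> (\<exists>t. (+) t ` sphere_packing X \<subseteq> (*\<^sub>R) (lambda_set C X) ` C)"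
    and "\<And>l. l > 0 \<Longrightarrow> (+) t ` sphere_packing X \<subseteq> (*\<^sub>R) l ` C \<Longrightarrow> lambda_set C X \<le> l"
proof -
  let ?P = "\<lambda>l. l > 0 \<and> (\<exists>t. (+) t ` sphere_packing X \<subseteq> (*\<^sub>R) l ` C)"
  define n where "n = card X"
  have n: "n > 0" using X by (auto simp: n_def card_gt_0_iff)
  obtain g where g: "X = g ` {..<n}"
    using ex_bij_betw_nat_finite[OF X(1)] by (auto simp: bij_betw_def n_def lessThan_atLeast0)
  define K where "K = (\<Inter>i\<in>{..<n}. {f. f i - f 0 = g i - g 0})"
  have K: "closed K" unfolding K_def
    by (intro closed_INT ballI closed_Collect_eq continuous_intros continuous_on_product_coordinates)
  obtain L t0 where L: "L > 0" "(+) t0 ` sphere_packing X \<subseteq> (*\<^sub>R) L ` C"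
    using bounded_in_scaled_body[OF C bounded_sphere_packing[OF X(1)]] by blast
  have tr: "(+) t ` sphere_packing X \<subseteq> S \<longleftrightarrow> (\<forall>i<n. cball (t + g i) (1/2) \<subseteq> S)" for t S
    unfolding sphere_packing_translate_iff by (auto simp: g)
  have inK: "(\<lambda>i. t + g i) \<in> K" for t by (simp add: K_def)
  have "\<exists>l f. f \<in> K \<and> l > 0 \<and> (\<forall>i<n. cball (f i) (1/2) \<subseteq> (*\<^sub>R) l ` C) \<and>
     (\<forall>l' f'. f' \<in> K \<and> l' > 0 \<and> (\<forall>i<n. cball (f' i) (1/2) \<subseteq> (*\<^sub>R) l' ` C) \<longrightarrow> l \<le> l')"
  proof (rule min_configuration[OF C n K _ inK L(1)])
    show "f' \<in> K" if "f \<in> K" "\<And>i. i < n \<Longrightarrow> f' i = f i" for f f' using that n by (auto simp: K_def)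
    show "cball (t0 + g i) (1/2) \<subseteq> (*\<^sub>R) L ` C" if "i < n" for i
      using L(2) that unfolding tr by blast
  qed
  then obtain l f where lf: "f \<in> K" "l > 0" "\<forall>i<n. cball (f i) (1/2) \<subseteq> (*\<^sub>R) l ` C"
    and min: "\<And>l' f'. f' \<in> K \<Longrightarrow> l' > 0 \<Longrightarrow> \<forall>i<n. cball (f' i) (1/2) \<subseteq> (*\<^sub>R) l' ` C \<Longrightarrow> l \<le> l'"
    by metis
  have "f i = (f 0 - g 0) + g i" if "i < n" for i
    using lf(1) that by (auto simp: K_def algebra_simps)
  then have "(+) (f 0 - g 0) ` sphere_packing X \<subseteq> (*\<^sub>R) l ` C"
    unfolding tr using lf(3) by metis
  with lf(2) have 1: "?P l" by blast
  have 2: "l \<le> l'" if "?P l'" for l' using that min[OF inK] unfolding tr by blast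
  note LEAST_real_min[of ?P, OF 1 2]
  then show "lambda_set C X > 0 \<and> (\<exists>t. (+) t ` sphere_packing X \<subseteq> (*\<^sub>R) (lambda_set C X) ` C)"
    and "\<And>l. l > 0 \<Longrightarrow> (+) t ` sphere_packing X \<subseteq> (*\<^sub>R) l ` C \<Longrightarrow> lambda_set C X \<le> l"
    unfolding lambda_set_def by blast+
qed

lemma packing_set_finite_iff:
  "finite X \<Longrightarrow> packing_set X \<longleftrightarrow> (\<forall>x\<in>X. \<forall>x'\<in>X. x \<noteq> x' \<longrightarrow> norm (x - x') \<ge> 1)"
proof -
  have "discrete X" if "\<forall>x\<in>X. \<forall>x'\<in>X. x \<noteq> x' \<longrightarrow> norm (x - x') \<ge> 1"
  proof (rule uniform_discrete_imp_discrete)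
    show "uniform_discrete X" unfolding uniform_discrete_def
      using that by (intro exI[of _ 1]) (force simp: dist_norm)
  qed
  then show ?thesis by (auto simp: packing_set_def)
qed

lemma lambda_num_is_min:
  fixes C :: "'a::euclidean_space set"
  assumes C: "convex_body C" and n: "n > 0"
  shows "\<exists>X. attains_lambda C n X"
    and "\<And>X. packing_set X \<Longrightarrow> finite X \<Longrightarrow> card X = n \<Longrightarrow> lambda_num C n \<le> lambda_set C X"
proof -
  let ?Q = "\<lambda>l. \<exists>X. packing_set X \<and> finite X \<and> card X = n \<and> l = lambda_set C X"
  define K :: "(nat \<Rightarrow> 'a) set" where
    "K = (\<Inter>i\<in>{..<n}. \<Inter>j\<in>{..<n} - {i}. {f. 1 \<le> norm (f i - f j)})"
  have K: "closed K" unfolding K_def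
    by (intro closed_INT ballI closed_Collect_le continuous_intros continuous_on_product_coordinates)
  have conf: "\<exists>f\<in>K. \<forall>i<n. cball (f i) (1/2) \<subseteq> S"
    if A: "packing_set X" "finite X" "card X = n" "(+) t ` sphere_packing X \<subseteq> S" for X t and S :: "'a set"
  proof -
    obtain g where g: "bij_betw g {..<n} X"
      using ex_bij_betw_nat_finite[OF A(2)] A(3) by (auto simp: lessThan_atLeast0)
    have "1 \<le> norm (g i - g j)" if "i < n" "j < n" "i \<noteq> j" for i j
    proof -
      have "g i \<in> X" "g j \<in> X" "g i \<noteq> g j"
        using g that by (auto simp: bij_betw_def inj_on_def)
      then show ?thesis using A(1) unfolding packing_set_def by blast
    qed
    then have "(\<lambda>i. t + g i) \<in> K" by (auto simp: K_def)
    moreover have "\<forall>i<n. cball (t + g i) (1/2) \<subseteq> S"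
      using A(4) g unfolding sphere_packing_translate_iff bij_betw_def by auto
    ultimately show ?thesis by (intro bexI[of _ "\<lambda>i. t + g i"]) auto
  qed
  obtain b :: 'a where b: "b \<in> Basis" using nonempty_Basis by blast
  define X0 where "X0 = (\<lambda>i. real i *\<^sub>R b) ` {..<n}"
  have "inj_on (\<lambda>i. real i *\<^sub>R b) {..<n}" using b by (auto simp: inj_on_def)
  then have X0: "finite X0" "card X0 = n" by (auto simp: X0_def card_image)
  have "1 \<le> norm (real i *\<^sub>R b - real j *\<^sub>R b)" if "i \<noteq> j" for i j
  proof -
    have "norm (real i *\<^sub>R b - real j *\<^sub>R b) = \<bar>real i - real j\<bar>"
      using b by (simp flip: scaleR_diff_left)
    then show ?thesis using that by linarith
  qed
  then have pX0: "packing_set X0" unfolding packing_set_finite_iff[OF X0(1)] by (auto simp: X0_def)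
  obtain L t0 where L: "L > 0" "(+) t0 ` sphere_packing X0 \<subseteq> (*\<^sub>R) L ` C"
    using bounded_in_scaled_body[OF C bounded_sphere_packing[OF X0(1)]] by blast
  obtain f0 where f0: "f0 \<in> K" "\<forall>i<n. cball (f0 i) (1/2) \<subseteq> (*\<^sub>R) L ` C"
    using conf[OF pX0 X0 L(2)] by blast
  have "\<exists>l f. f \<in> K \<and> l > 0 \<and> (\<forall>i<n. cball (f i) (1/2) \<subseteq> (*\<^sub>R) l ` C) \<and>
     (\<forall>l' f'. f' \<in> K \<and> l' > 0 \<and> (\<forall>i<n. cball (f' i) (1/2) \<subseteq> (*\<^sub>R) l' ` C) \<longrightarrow> l \<le> l')"
  proof (rule min_configuration[OF C n K _ f0(1) L(1)])
    show "f' \<in> K" if "f \<in> K" "\<And>i. i < n \<Longrightarrow> f' i = f i" for f f' using that by (auto simp: K_def)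
  qed (use f0 in blast)
  then obtain l f where lf: "f \<in> K" "l > 0" "\<forall>i<n. cball (f i) (1/2) \<subseteq> (*\<^sub>R) l ` C"
    and min: "\<And>l' f'. f' \<in> K \<Longrightarrow> l' > 0 \<Longrightarrow> \<forall>i<n. cball (f' i) (1/2) \<subseteq> (*\<^sub>R) l' ` C \<Longrightarrow> l \<le> l'"
    by metis
  have low: "l \<le> lambda_set C X" if "packing_set X" "finite X" "card X = n" for X
  proof -
    have "X \<noteq> {}" using that n by auto
    from lambda_set_is_min(1)[OF C that(2) this] conf[OF that] min show ?thesis by blast
  qed
  define X1 where "X1 = f ` {..<n}"
  have fK: "1 \<le> norm (f i - f j)" if "i < n" "j < n" "i \<noteq> j" for i j
    using lf(1) that by (auto simp: K_def)
  have "inj_on f {..<n}"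
  proof (rule inj_onI, rule ccontr)
    fix i j assume "i \<in> {..<n}" "j \<in> {..<n}" "f i = f j" "i \<noteq> j"
    with fK[of i j] show False by simp
  qed
  then have X1: "finite X1" "card X1 = n" by (auto simp: X1_def card_image)
  have pX1: "packing_set X1" unfolding packing_set_finite_iff[OF X1(1)]
    using fK by (auto simp: X1_def)
  have "X1 \<noteq> {}" using n by (auto simp: X1_def)
  have "(+) 0 ` sphere_packing X1 \<subseteq> (*\<^sub>R) l ` C"
    unfolding sphere_packing_translate_iff using lf(3) by (simp add: X1_def)
  from lambda_set_is_min(2)[OF C X1(1) \<open>X1 \<noteq> {}\<close> lf(2) this]
  have "lambda_set C X1 = l" using low[OF pX1 X1] by simp
  then have 1: "?Q l" using pX1 X1 by blast
  have 2: "l \<le> l'" if "?Q l'" for l' using that low by blast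
  note L = LEAST_real_min[of ?Q, OF 1 2]
  show "\<exists>X. attains_lambda C n X" using L(1) unfolding attains_lambda_def lambda_num_def
    by metis
  show "\<And>X. packing_set X \<Longrightarrow> finite X \<Longrightarrow> card X = n \<Longrightarrow> lambda_num C n \<le> lambda_set C X"
    using L(2) unfolding lambda_num_def by blast
qed

end

theory Submission
  imports Defs
begin

text \<open>Suppose that \<open>X \<in> F\<close> attains \<open>\<lambda>(C,n)\<close> with \<open>n\<close>, and hence \<open>\<lambda> = \<lambda>(C,n)\<close>, large, and place its
  balls in \<open>\<lambda>C\<close>. By minimality the points cannot all be moved into the interior of the inner parallel
  body \<open>P\<close> of \<open>\<lambda>C\<close>; call the points on the boundary of \<open>P\<close> contacts.

  Contacts are relatively dense along the boundary. Take \<open>p\<close> outside \<open>P\<close> at bounded distance, let \<open>q\<close> be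
  a deep interior point, and set \<open>g x = |x - p| + \<kappa>|x - q|\<^sup>2\<close> with \<open>\<kappa>\<close> of order \<open>1/\<lambda>\<close>.
  The gradient of \<open>g\<close> is bounded away from 0, the second derivative is small, and away from \<open>p\<close> the
  gradient points outward at the boundary. Process the points in the order of increasing \<open>g\<close>: all
  unprocessed neighbours of the current point lie almost on one side of it, and by condition (ii)
  a small change of \<open>-\<nabla>g\<close> gives a direction in which no contact with them is obstructed. So if
  there were no contact within a fixed distance \<open>L\<close> of \<open>p\<close>, all points could be moved into the interior.

  On the other hand, by condition (i) the (rotated) differences of points of the packings form a set
  with countable closure, so there is a direction \<open>u\<close> almost orthogonal to none of those with norm in
  \<open>[1, 4L + 1]\<close>. Since \<open>C\<close> is smooth, the boundary of \<open>\<lambda>C\<close> is nearly flat where its normal is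
  \<open>u\<close>, and two nearby contacts there have a difference almost orthogonal to \<open>u\<close>, a contradiction.\<close>

section \<open>Perturbing a vector into the polar cone of finitely many vectors\<close>

text \<open>As in the proof of Caratheodory's theorem, an affine relation representing 0 is
  subtracted until a coefficient vanishes. The reduction stops once 0 is outside the affine hull,
  where the gap hypothesis of the next lemmas applies.\<close>

lemma conic_combination_affine_reduction:
  fixes w :: "'a::euclidean_space"
  assumes "finite T" "\<And>y. y \<in> T \<Longrightarrow> 0 \<le> c y" "w = (\<Sum>y\<in>T. c y *\<^sub>R y)"
  shows "\<exists>T' c'. T' \<subseteq> T \<and> (\<forall>y\<in>T'. 0 \<le> c' y) \<and> w = (\<Sum>y\<in>T'. c' y *\<^sub>R y) \<and> 0 \<notin> affine hull T'"
  using assms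
proof (induction T arbitrary: c rule: finite_psubset_induct)
  case (psubset T)
  show ?case
  proof (cases "0 \<in> affine hull T")
    case False
    with psubset.prems show ?thesis by blast
  next
    case True
    then obtain u where u: "sum u T = 1" "(\<Sum>y\<in>T. u y *\<^sub>R y) = 0"
      using affine_hull_finite[OF psubset.hyps] by auto
    \<comment> \<open>Some \<open>u y\<close> is positive since they sum to 1. The least ratio
      \<open>c y / u y\<close> over these is the largest multiple of \<open>u\<close> whose
      subtraction keeps all coefficients nonnegative.\<close>
    define P where "P = {y\<in>T. u y > 0}"
    have "P \<noteq> {}"
    proof
      assume "P = {}"
      then have "sum u T \<le> 0" by (intro sum_nonpos) (auto simp: P_def not_less)
      with u(1) show False by simp
    qed
    moreover have finP: "finite P" using psubset.hyps by (simp add: P_def)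
    ultimately obtain z where z: "z \<in> P" "\<And>y. y \<in> P \<Longrightarrow> c z / u z \<le> c y / u y"
      using ex_is_arg_min_if_finite[of P "\<lambda>y. c y / u y"] by (auto simp: is_arg_min_linorder)
    define t where "t = c z / u z"
    have uz: "u z > 0" "z \<in> T" using z by (auto simp: P_def)
    have t: "t \<ge> 0" using psubset.prems(1)[OF uz(2)] uz by (simp add: t_def)
    define c' where "c' y = c y - t * u y" for y
    have c'0: "0 \<le> c' y" if "y \<in> T" for y
    proof (cases "u y > 0")
      case True
      then have "t \<le> c y / u y" using z that by (simp add: P_def t_def)
      with True show ?thesis by (simp add: c'_def field_simps)
    next
      case False
      then have "t * u y \<le> 0" using t by (simp add: mult_nonneg_nonpos)
      then show ?thesis using psubset.prems(1)[OF that] by (simp add: c'_def)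
    qed
    have "c' z = 0" using uz by (simp add: c'_def t_def)
    have "(\<Sum>y\<in>T. c' y *\<^sub>R y) = w - t *\<^sub>R (\<Sum>y\<in>T. u y *\<^sub>R y)"
      by (simp add: c'_def psubset.prems(2) scaleR_diff_left sum_subtractf scaleR_sum_right)
    then have "w = (\<Sum>y\<in>T. c' y *\<^sub>R y)" using u by simp
    also have "\<dots> = (\<Sum>y\<in>T - {z}. c' y *\<^sub>R y)"
      using sum.remove[OF psubset.hyps uz(2), of "\<lambda>y. c' y *\<^sub>R y"] \<open>c' z = 0\<close> by simp
    finally have "w = (\<Sum>y\<in>T - {z}. c' y *\<^sub>R y)" .
    moreover have "T - {z} \<subset> T" using uz by auto
    ultimately obtain T' d where "T' \<subseteq> T - {z}" "\<forall>y\<in>T'. 0 \<le> d y"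
      "w = (\<Sum>y\<in>T'. d y *\<^sub>R y)" "0 \<notin> affine hull T'"
      using psubset.IH[of "T - {z}" c'] c'0 by auto
    then show ?thesis by blast
  qed
qed

text \<open>After the reduction, division by the coefficient sum \<open>s\<close> puts
  \<open>w\<close> into the affine hull of \<open>T\<close>. The gap bounds \<open>s\<close> by
  \<open>norm w / \<rho>\<close>, and each unit of coefficient contributes at most
  \<open>\<delta>\<close> to \<open>v \<bullet> w\<close>.\<close>

lemma norm_convex_cone_hull_le:
  fixes N :: "'a::euclidean_space set"
  assumes fin: "finite N" and w: "w \<in> convex_cone hull N" and "\<rho> > 0"
    and gap: "\<And>T z. T \<subseteq> N \<Longrightarrow> 0 \<notin> affine hull T \<Longrightarrow> z \<in> affine hull T \<Longrightarrow> \<rho> \<le> norm z"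
    and le: "\<And>y. y \<in> N \<Longrightarrow> v \<bullet> y \<le> \<delta>" and "\<delta> \<ge> 0"
  shows "v \<bullet> w \<le> \<delta> / \<rho> * norm w"
proof (cases "w = 0")
  case False
  then obtain x r where x: "x \<in> convex hull N" "r \<ge> 0" "w = r *\<^sub>R x"
    using w unfolding convex_cone_hull_convex_hull by auto
  obtain a where a: "\<forall>y\<in>N. 0 \<le> a y" "sum a N = 1" "(\<Sum>y\<in>N. a y *\<^sub>R y) = x"
    using x(1) unfolding convex_hull_finite[OF fin] by auto
  have "w = (\<Sum>y\<in>N. (r * a y) *\<^sub>R y)"
    by (simp add: x(3) scaleR_sum_right flip: a(3))
  then obtain T c where T: "T \<subseteq> N" "\<forall>y\<in>T. 0 \<le> c y" "w = (\<Sum>y\<in>T. c y *\<^sub>R y)" "0 \<notin> affine hull T"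
    using conic_combination_affine_reduction[OF fin, of "\<lambda>y. r * a y" w] a x(2) by auto
  have finT: "finite T" using T fin finite_subset by blast
  define s where "s = sum c T"
  have "s > 0"
  proof (rule ccontr)
    assume "\<not> s > 0"
    then have "sum c T = 0" using T(2) sum_nonneg[of T c] by (simp add: s_def)
    then have "\<forall>y\<in>T. c y = 0" using T(2) sum_nonneg_eq_0_iff[OF finT] by blast
    with T(3) False show False by simp
  qed
  have "(1 / s) *\<^sub>R w \<in> affine hull T"
    unfolding affine_hull_finite[OF finT] T(3) scaleR_sum_right
    using \<open>s > 0\<close> by (auto intro!: exI[of _ "\<lambda>y. c y / s"] simp: s_def simp flip: sum_divide_distrib)
  from gap[OF T(1) T(4) this] have "\<rho> * s \<le> norm w"
    using \<open>s > 0\<close> by (simp add: field_simps)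
  have "v \<bullet> w = (\<Sum>y\<in>T. c y * (v \<bullet> y))" by (simp add: T(3) inner_sum_right)
  also have "\<dots> \<le> (\<Sum>y\<in>T. c y * \<delta>)" using T le by (intro sum_mono mult_left_mono) auto
  also have "\<dots> = s * \<delta>" by (simp add: s_def sum_distrib_right)
  also have "\<dots> \<le> \<delta> / \<rho> * norm w"
    using mult_right_mono[OF \<open>\<rho> * s \<le> norm w\<close> \<open>\<delta> \<ge> 0\<close>] \<open>\<rho> > 0\<close> by (simp add: field_simps)
  finally show ?thesis .
qed simp

text \<open>Subtracting from \<open>v\<close> its projection \<open>w\<close> onto the cone spanned
  by \<open>N\<close> leaves a vector of the polar cone (Moreau decomposition). Since
  \<open>v \<bullet> w\<close> is the square of \<open>norm w\<close>, the preceding bound limits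
  the length of \<open>w\<close>.\<close>

lemma polar_cone_perturbation:
  fixes N :: "'a::euclidean_space set"
  assumes fin: "finite N" and "\<rho> > 0"
    and gap: "\<And>T z. T \<subseteq> N \<Longrightarrow> 0 \<notin> affine hull T \<Longrightarrow> z \<in> affine hull T \<Longrightarrow> \<rho> \<le> norm z"
    and le: "\<And>y. y \<in> N \<Longrightarrow> v \<bullet> y \<le> \<delta>" and "\<delta> \<ge> 0"
  shows "\<exists>v'. norm (v' - v) \<le> \<delta> / \<rho> \<and> (\<forall>y\<in>N. v' \<bullet> y \<le> 0)"
proof -
  define K where "K = convex_cone hull N"
  have K: "closed K" "convex K" "K \<noteq> {}"
    using closed_convex_cone_hull[OF fin] convex_convex_cone_hull[of N] convex_cone_hull_nonempty[of N]
    by (simp_all add: K_def)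
  define w where "w = closest_point K v"
  have w: "w \<in> K" using closest_point_in_set K by (simp add: w_def)
  have dot: "(v - w) \<bullet> (k - w) \<le> 0" if "k \<in> K" for k
    using closest_point_dot[OF K(2,1) that] by (simp add: w_def)
  have "v \<bullet> w = norm w * norm w"
  proof -
    \<comment> \<open>Testing the projection inequality at 0 and at twice \<open>w\<close> gives
      both signs, hence orthogonality of \<open>v - w\<close> and \<open>w\<close>.\<close>
    have "0 \<in> K" "2 *\<^sub>R w \<in> K"
      using w convex_cone_hull_contains_0 convex_cone_hull_mul[of w N 2] by (auto simp: K_def)
    then have "(v - w) \<bullet> (0 - w) \<le> 0" "(v - w) \<bullet> (2 *\<^sub>R w - w) \<le> 0" by (intro dot; simp)+
    then have "(v - w) \<bullet> w = 0" by (simp add: scaleR_2)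
    then show ?thesis by (simp add: inner_diff_left dot_square_norm power2_eq_square)
  qed
  moreover have "v \<bullet> w \<le> \<delta> / \<rho> * norm w"
    by (rule norm_convex_cone_hull_le[OF fin w[unfolded K_def] \<open>\<rho> > 0\<close> gap le \<open>\<delta> \<ge> 0\<close>])
  ultimately have nw: "norm w \<le> \<delta> / \<rho>"
    using \<open>\<rho> > 0\<close> \<open>\<delta> \<ge> 0\<close>
    by (cases "w = 0") (simp, metis mult_le_cancel_right_pos zero_less_norm_iff)
  have "(v - w) \<bullet> y \<le> 0" if "y \<in> N" for y
  proof -
    have "y \<in> K" unfolding K_def by (rule hull_inc[OF that])
    then have "w + y \<in> K" using w unfolding K_def by (metis convex_cone_hull_add)
    from dot[OF this] show ?thesis by simp
  qed
  with nw show ?thesis by (intro exI[of _ "v - w"]) simp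
qed

section \<open>Moving packing points into the interior of a convex set\<close>

text \<open>If the open ray from \<open>x\<close> along \<open>v\<close> missed the interior, a
  hyperplane separating the two would support \<open>S\<close> at \<open>x\<close>, with an outer
  normal whose product with \<open>v\<close> is nonnegative.\<close>

lemma inward_direction:
  fixes S :: "'a::euclidean_space set"
  assumes S: "convex S" "interior S \<noteq> {}" and x: "x \<in> S"
    and inward: "\<And>u. norm u = 1 \<Longrightarrow> (\<And>s. s \<in> S \<Longrightarrow> u \<bullet> s \<le> u \<bullet> x) \<Longrightarrow> u \<bullet> v < 0"
  shows "\<exists>e>0. x + e *\<^sub>R v \<in> interior S"
proof (rule ccontr)
  assume no: "\<not> ?thesis"
  define R where "R = (\<lambda>e::real. x + e *\<^sub>R v) ` {0<..}"
  have "convex ((\<lambda>e::real. e *\<^sub>R v) ` {0<..})"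
    by (intro convex_linear_image linear_scaleR_left convex_real_interval)
  then have "convex ((+) x ` (\<lambda>e::real. e *\<^sub>R v) ` {0<..})" by (rule convex_translation)
  then have "convex R" by (simp add: R_def image_image)
  moreover have "R \<noteq> {}" "interior S \<inter> R = {}" using no by (auto simp: R_def)
  ultimately obtain a b where a: "a \<noteq> 0" "\<forall>s\<in>interior S. a \<bullet> s \<le> b" "\<forall>s\<in>R. a \<bullet> s \<ge> b"
    using separating_hyperplane_sets[of "interior S" R] S by auto
  have "closure (interior S) \<subseteq> {s. a \<bullet> s \<le> b}"
    using a(2) by (intro closure_minimal closed_halfspace_le) auto
  then have S_le: "a \<bullet> s \<le> b" if "s \<in> S" for s
    using that closure_subset[of S] by (auto simp: convex_closure_interior[OF S])
  have R_ge: "b \<le> a \<bullet> x + e * (a \<bullet> v)" if "e > 0" for e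
    using a(3) that by (force simp: R_def inner_add_right)
  have "((\<lambda>e. a \<bullet> x + e * (a \<bullet> v)) \<longlongrightarrow> a \<bullet> x + 0 * (a \<bullet> v)) (at_right 0)"
    by (intro tendsto_intros)
  moreover have "eventually (\<lambda>e. b \<le> a \<bullet> x + e * (a \<bullet> v)) (at_right 0)"
    using R_ge eventually_at_right_less[of "0::real"] by (auto elim: eventually_mono)
  ultimately have "b \<le> a \<bullet> x + 0 * (a \<bullet> v)"
    by (rule tendsto_lowerbound) simp
  then have xb: "a \<bullet> x = b" using S_le[OF x] by simp
  define u where "u = (1 / norm a) *\<^sub>R a"
  have "norm u = 1" using a(1) by (simp add: u_def)
  moreover have "u \<bullet> s \<le> u \<bullet> x" if "s \<in> S" for s
    using S_le[OF that] xb by (simp add: u_def divide_right_mono)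
  ultimately have "u \<bullet> v < 0" by (rule inward)
  then have "a \<bullet> v < 0" by (simp add: u_def field_simps zero_less_mult_iff divide_less_0_iff)
  then show False using R_ge[of 1] xb by simp
qed

text \<open>A neighbour at distance 1 recedes even if \<open>v\<close> is orthogonal to
  \<open>y - x\<close>, owing to the second-order term \<open>e\<^sup>2 * (norm v)\<^sup>2\<close>.
  All other points stay farther away than 1 by continuity.\<close>

lemma small_step_separates:
  fixes x v :: "'a::euclidean_space"
  assumes "finite Y" "v \<noteq> 0" "\<And>y. y \<in> Y \<Longrightarrow> norm (x - y) \<ge> 1"
    and "\<And>y. y \<in> Y \<Longrightarrow> norm (x - y) = 1 \<Longrightarrow> v \<bullet> (y - x) \<le> 0"
  shows "\<exists>e>0. e \<le> 1 \<and> (\<forall>y\<in>Y. norm (x + e *\<^sub>R v - y) > 1)"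
proof -
  have "eventually (\<lambda>e. norm (x + e *\<^sub>R v - y) > 1) (at_right 0)" if "y \<in> Y" for y
  proof (cases "norm (x - y) = 1")
    case True
    have "norm (x + e *\<^sub>R v - y) > 1" if "e > 0" for e
    proof -
      have "(norm (x + e *\<^sub>R v - y))\<^sup>2 = (norm (x - y))\<^sup>2 - 2 * e * (v \<bullet> (y - x)) + e\<^sup>2 * (norm v)\<^sup>2"
        unfolding power2_norm_eq_inner by (simp add: algebra_simps inner_commute power2_eq_square)
      moreover have "e * (v \<bullet> (y - x)) \<le> 0"
        using assms(4)[OF \<open>y \<in> Y\<close> True] that by (simp add: mult_nonneg_nonpos)
      moreover have "e\<^sup>2 * (norm v)\<^sup>2 > 0" using that \<open>v \<noteq> 0\<close> by simp
      ultimately have "(norm (x + e *\<^sub>R v - y))\<^sup>2 > 1\<^sup>2" using True by simp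
      then show ?thesis by (rule power2_less_imp_less) simp
    qed
    then show ?thesis using eventually_at_right_less[of "0::real"] by (auto elim: eventually_mono)
  next
    case False
    with assms(3)[OF that] have "norm (x - y) > 1" by simp
    moreover have "((\<lambda>e. norm (x + e *\<^sub>R v - y)) \<longlongrightarrow> norm (x + 0 *\<^sub>R v - y)) (at_right 0)"
      by (intro tendsto_intros)
    ultimately show ?thesis by (auto dest: order_tendstoD(1))
  qed
  then have "eventually (\<lambda>e. \<forall>y\<in>Y. norm (x + e *\<^sub>R v - y) > 1) (at_right 0)"
    using assms(1) by (simp add: eventually_ball_finite)
  moreover have "eventually (\<lambda>e::real. 0 < e \<and> e < 1) (at_right 0)"
    by (auto simp: eventually_at_right_field intro!: exI[of _ 1])
  ultimately have "eventually (\<lambda>e. 0 < e \<and> e < 1 \<and> (\<forall>y\<in>Y. norm (x + e *\<^sub>R v - y) > 1)) (at_right 0)"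
    by eventually_elim auto
  then obtain e where "0 < e" "e < 1" "\<forall>y\<in>Y. norm (x + e *\<^sub>R v - y) > 1"
    using eventually_happens[of _ "at_right (0::real)"] trivial_limit_at_right_real by blast
  then show ?thesis by (intro exI[of _ e]) auto
qed

text \<open>\<open>Z\<close> collects the points already moved, which no longer touch any other point, and \<open>U\<close> those
  still to be moved.\<close>

lemma packing_moves_into_interior:
  fixes S :: "'a::euclidean_space set"
  assumes S: "convex S"
    and "finite U" "finite Z" "U \<inter> Z = {}" "U \<subseteq> S" "Z \<subseteq> interior S"
    and "\<And>x y. x \<in> U \<Longrightarrow> y \<in> U \<Longrightarrow> x \<noteq> y \<Longrightarrow> norm (x - y) \<ge> 1"
    and "\<And>x y. x \<in> Z \<Longrightarrow> y \<in> U \<union> Z \<Longrightarrow> x \<noteq> y \<Longrightarrow> norm (x - y) > 1"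
    and "\<And>V. V \<subseteq> U \<Longrightarrow> V \<noteq> {} \<Longrightarrow>
       \<exists>x\<in>V. \<exists>v. v \<noteq> 0 \<and> x + v \<in> interior S \<and> (\<forall>y\<in>V. norm (x - y) = 1 \<longrightarrow> v \<bullet> (y - x) \<le> 0)"
  shows "\<exists>X. finite X \<and> card X = card U + card Z \<and> X \<subseteq> interior S \<and>
     (\<forall>x\<in>X. \<forall>y\<in>X. x \<noteq> y \<longrightarrow> norm (x - y) \<ge> 1)"
  using assms(2-)
proof (induction "card U" arbitrary: U Z)
  case 0
  then have "U = {}" by simp
  with 0 show ?case by (intro exI[of _ Z]) (auto intro: less_imp_le)
next
  case (Suc n)
  then have "U \<noteq> {}" by auto
  \<comment> \<open>The hypothesis covers all nonempty \<open>V\<close>, because \<open>U\<close>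
    loses a point in each round.\<close>
  with Suc.prems(8)[of U] obtain x v where x: "x \<in> U" and v: "v \<noteq> 0" "x + v \<in> interior S"
    "\<And>y. y \<in> U \<Longrightarrow> norm (x - y) = 1 \<Longrightarrow> v \<bullet> (y - x) \<le> 0" by blast
  define Y where "Y = (U - {x}) \<union> Z"
  have Zx: "norm (x - y) > 1" if "y \<in> Z" for y
  proof -
    have "y \<noteq> x" using that x Suc.prems(3) by auto
    then show ?thesis using Suc.prems(7)[OF that, of x] x by (simp add: norm_minus_commute)
  qed
  have "\<exists>e>0. e \<le> 1 \<and> (\<forall>y\<in>Y. norm (x + e *\<^sub>R v - y) > 1)"
  proof (rule small_step_separates)
    show "finite Y" using Suc.prems by (simp add: Y_def)
    show "norm (x - y) \<ge> 1" if "y \<in> Y" for y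
      using that Zx[of y] Suc.prems(6)[OF x, of y] by (auto simp: Y_def)
    show "v \<bullet> (y - x) \<le> 0" if "y \<in> Y" "norm (x - y) = 1" for y
      using that v(3)[of y] Zx[of y] by (auto simp: Y_def)
  qed (rule v)
  then obtain e where e: "e > 0" "e \<le> 1" "\<And>y. y \<in> Y \<Longrightarrow> norm (x + e *\<^sub>R v - y) > 1" by blast
  define z where "z = x + e *\<^sub>R v"
  have "x \<in> S" using x Suc.prems by blast
  \<comment> \<open>The segment from \<open>x\<close> to the interior point \<open>x + v\<close> is
    interior except possibly at \<open>x\<close>, so the step may be shortened.\<close>
  from mem_interior_convex_shrink[OF S v(2) this e(1,2)] have z_int: "z \<in> interior S"
    by (simp add: z_def)
  have z_far: "norm (z - y) > 1" if "y \<in> Y" for y using e(3)[OF that] by (simp add: z_def)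
  have zY: "z \<notin> Y" using z_far[of z] by auto
  have "\<exists>X. finite X \<and> card X = card (U - {x}) + card (insert z Z) \<and> X \<subseteq> interior S \<and>
     (\<forall>x\<in>X. \<forall>y\<in>X. x \<noteq> y \<longrightarrow> norm (x - y) \<ge> 1)"
  proof (rule Suc.hyps(1))
    show "n = card (U - {x})" using Suc.hyps(2) x Suc.prems(1) by simp
    show "finite (U - {x})" "finite (insert z Z)" using Suc.prems by simp_all
    show "(U - {x}) \<inter> insert z Z = {}" using Suc.prems(3) zY by (auto simp: Y_def)
    show "U - {x} \<subseteq> S" "insert z Z \<subseteq> interior S" using Suc.prems z_int by auto
    show "norm (a - b) \<ge> 1" if "a \<in> U - {x}" "b \<in> U - {x}" "a \<noteq> b" for a b
      using that Suc.prems(6) by auto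
    show "norm (a - b) > 1" if "a \<in> insert z Z" "b \<in> (U - {x}) \<union> insert z Z" "a \<noteq> b" for a b
    proof (cases "a = z")
      case True
      then show ?thesis using that z_far[of b] by (auto simp: Y_def)
    next
      case False
      then have a: "a \<in> Z" using that by simp
      show ?thesis
      proof (cases "b = z")
        case True
        then show ?thesis using z_far[of a] a by (auto simp: Y_def norm_minus_commute)
      next
        case False
        then show ?thesis using Suc.prems(7)[OF a, of b] that by auto
      qed
    qed
    show "\<exists>x\<in>V. \<exists>v. v \<noteq> 0 \<and> x + v \<in> interior S \<and> (\<forall>y\<in>V. norm (x - y) = 1 \<longrightarrow> v \<bullet> (y - x) \<le> 0)"
      if "V \<subseteq> U - {x}" "V \<noteq> {}" for V
      using that Suc.prems(8)[of V] by auto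
  qed
  moreover have "card (U - {x}) + card (insert z Z) = card U + card Z"
  proof -
    have "z \<notin> Z" using zY by (simp add: Y_def)
    then show ?thesis using Suc.prems(2) card.remove[OF Suc.prems(1) x] by simp
  qed
  ultimately show ?case by (simp only:)
qed

section \<open>Inner parallel bodies and smaller dilates\<close>

text \<open>The Minkowski difference of \<open>S\<close> and the ball of radius 1/2: a packing fits
  into \<open>S\<close> exactly when its centres lie here, so points can be treated instead of
  balls.\<close>

definition inner_parallel :: "'a::euclidean_space set \<Rightarrow> 'a set" where
  "inner_parallel S = {x. cball x (1/2) \<subseteq> S}"

lemma mem_inner_parallel_iff:
  "x \<in> inner_parallel S \<longleftrightarrow> (\<forall>u. norm u \<le> 1/2 \<longrightarrow> x + u \<in> S)"
proof -
  have "cball x (1/2) = (+) x ` cball 0 (1/2)" using cball_translation[of x 0 "1/2"] by simp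
  then show ?thesis unfolding inner_parallel_def by (simp only: mem_Collect_eq image_subset_iff Ball_def mem_cball_0)
qed

lemma convex_inner_parallel:
  assumes "convex S" shows "convex (inner_parallel S)"
proof (rule convexI)
  fix x y :: 'a and a b :: real
  assume xy: "x \<in> inner_parallel S" "y \<in> inner_parallel S" and ab: "0 \<le> a" "0 \<le> b" "a + b = 1"
  have "a *\<^sub>R x + b *\<^sub>R y + u \<in> S" if "norm u \<le> 1/2" for u
  proof -
    have "a *\<^sub>R (x + u) + b *\<^sub>R (y + u) \<in> S"
      using xy that by (intro convexD[OF assms] ab) (auto simp: mem_inner_parallel_iff)
    also have "a *\<^sub>R (x + u) + b *\<^sub>R (y + u) = a *\<^sub>R x + b *\<^sub>R y + (a + b) *\<^sub>R u"
      by (simp add: algebra_simps)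
    finally show ?thesis using ab by simp
  qed
  then show "a *\<^sub>R x + b *\<^sub>R y \<in> inner_parallel S" by (simp add: mem_inner_parallel_iff)
qed

lemma cball_subset_inner_parallel:
  assumes "cball x (e + 1/2) \<subseteq> S" shows "cball x e \<subseteq> inner_parallel S"
proof
  fix y assume "y \<in> cball x e"
  then have "cball y (1/2) \<subseteq> cball x (e + 1/2)" by (auto simp: cball_subset_cball_iff dist_commute)
  with assms show "y \<in> inner_parallel S" by (auto simp: inner_parallel_def)
qed

lemma inner_parallel_subset: "inner_parallel S \<subseteq> S"
  by (force simp: inner_parallel_def)

text \<open>Finitely many centres have a common margin \<open>e\<close>. For small \<open>k\<close>
  it absorbs the displacement from \<open>y\<close> to \<open>(1 + k) *\<^sub>R y\<close>, so the
  packing, enlarged from the origin by \<open>1 + k\<close>, still lies in the dilate.\<close>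

lemma lambda_set_less:
  fixes C :: "'a::euclidean_space set"
  assumes C: "convex_body C" and X: "finite X" "X \<noteq> {}" and "l > 0"
    and int: "X \<subseteq> interior (inner_parallel ((*\<^sub>R) l ` C))"
  shows "lambda_set C X < l"
proof -
  obtain e where e: "e > 0" "(\<Union>x\<in>X. ball x e) \<subseteq> inner_parallel ((*\<^sub>R) l ` C)"
    using compact_subset_open_imp_ball_epsilon_subset[OF finite_imp_compact[OF X(1)] open_interior int]
      interior_subset by (metis subset_trans)
  obtain M where M: "M > 0" "\<And>x. x \<in> sphere_packing X \<Longrightarrow> norm x \<le> M"
    using bounded_sphere_packing[OF X(1)] bounded_pos by blast
  define k where "k = e / (2 * M)"
  have k: "k > 0" "k * M < e" using e M by (simp_all add: k_def)
  have "y \<in> (*\<^sub>R) (l / (1 + k)) ` C" if y: "y \<in> sphere_packing X" for y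
  proof -
    obtain x where x: "x \<in> X" "y \<in> cball x (1/2)"
      using y unfolding sphere_packing_def by (rule UN_E)
    have "k * norm y < e" using mult_left_mono[OF M(2)[OF y], of k] k by linarith
    then have "x + k *\<^sub>R y \<in> ball x e" using k by (simp add: dist_norm)
    then have "x + k *\<^sub>R y \<in> inner_parallel ((*\<^sub>R) l ` C)" using e(2) x(1) by blast
    moreover have "norm (y - x) \<le> 1/2" using x(2) by (simp add: dist_norm norm_minus_commute)
    ultimately have "x + k *\<^sub>R y + (y - x) \<in> (*\<^sub>R) l ` C"
      unfolding mem_inner_parallel_iff by blast
    then obtain c where "c \<in> C" "(1 + k) *\<^sub>R y = l *\<^sub>R c" by (auto simp: algebra_simps)
    moreover have "y = (1 / (1 + k)) *\<^sub>R ((1 + k) *\<^sub>R y)" using k by simp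
    ultimately have "y = (l / (1 + k)) *\<^sub>R c" by simp
    with \<open>c \<in> C\<close> show ?thesis by blast
  qed
  then have "(+) 0 ` sphere_packing X \<subseteq> (*\<^sub>R) (l / (1 + k)) ` C" by auto
  from lambda_set_is_min(2)[OF C X _ this] have "lambda_set C X \<le> l / (1 + k)"
    using \<open>l > 0\<close> k by simp
  also have "\<dots> < l" using \<open>l > 0\<close> k by (simp add: field_simps)
  finally show ?thesis .
qed

section \<open>Uniform flatness of smooth bodies\<close>

text \<open>Smoothness makes the two supporting hyperplanes coincide, which fixes the unit normal up
  to sign. The opposite sign would place \<open>C\<close> inside the hyperplane, against its
  nonempty interior.\<close>

lemma unique_unit_normal:
  fixes C :: "'a::euclidean_space set"
  assumes C: "smooth_convex_body C" and z: "z \<in> C"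
    and u: "norm u = 1" "\<And>c. c \<in> C \<Longrightarrow> u \<bullet> c \<le> u \<bullet> z"
    and m: "norm m = 1" "\<And>c. c \<in> C \<Longrightarrow> m \<bullet> c \<le> m \<bullet> z"
  shows "m = u"
proof -
  have cb: "convex_body C" using C by (simp add: smooth_convex_body_def)
  obtain c e where e: "e > 0" "cball c e \<subseteq> C"
    using cb unfolding convex_body_def by (meson ex_in_conv mem_interior_cball)
  have "z \<notin> interior C"
  proof
    assume "z \<in> interior C"
    then obtain d where d: "d > 0" "cball z d \<subseteq> C" by (meson mem_interior_cball)
    then have "z + d *\<^sub>R u \<in> C" using u(1) by (auto simp: dist_norm)
    from u(2)[OF this] show False using d u(1) by (simp add: inner_add_right dot_square_norm)
  qed
  then have zf: "z \<in> frontier C" using z closure_subset by (auto simp: frontier_def)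
  have "supporting_hyperplane_at C z {x. a \<bullet> x = a \<bullet> z}"
    if "norm a = 1" "\<And>c. c \<in> C \<Longrightarrow> a \<bullet> c \<le> a \<bullet> z" for a
    unfolding supporting_hyperplane_at_def using that z by (force intro!: exI[of _ a] exI[of _ "a \<bullet> z"])
  with u m C zf have H: "{x. u \<bullet> x = u \<bullet> z} = {x. m \<bullet> x = m \<bullet> z}"
    unfolding smooth_convex_body_def by (metis (no_types, lifting))
  \<comment> \<open>The component of \<open>m\<close> orthogonal to \<open>u\<close> is a direction
    of the common hyperplane and hence vanishes.\<close>
  define k where "k = m - (m \<bullet> u) *\<^sub>R u"
  have ku: "u \<bullet> k = 0" using u(1) by (simp add: k_def inner_diff_right dot_square_norm inner_commute)
  then have "z + k \<in> {x. u \<bullet> x = u \<bullet> z}" by (simp add: inner_add_right)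
  with H have "m \<bullet> k = 0" by (auto simp: inner_add_right)
  then have "k \<bullet> k = 0" using ku by (subst k_def) (simp add: inner_diff_left)
  then have mu: "m = (m \<bullet> u) *\<^sub>R u" by (simp add: k_def)
  then have "\<bar>m \<bullet> u\<bar> = 1" using u(1) m(1) by (metis mult.right_neutral norm_scaleR)
  then consider "m \<bullet> u = 1" | "m \<bullet> u = -1" by linarith
  then show ?thesis
  proof cases
    case 2
    with mu have "m = - u" by simp
    then have eq: "u \<bullet> y = u \<bullet> z" if "y \<in> C" for y using u(2)[OF that] m(2)[OF that] by simp
    have "c \<in> C" "c + e *\<^sub>R u \<in> C" using e u(1) by (auto simp: dist_norm)
    from this[THEN eq] show ?thesis using e u(1) by (simp add: inner_add_right dot_square_norm)
  qed (use mu in simp)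
qed

text \<open>Compactness makes \<open>\<tau>\<close> independent of the boundary point. For
  counterexamples with \<open>w\<close> tending to 0, the normals \<open>m\<close> separating
  \<open>z + w\<close> from \<open>C\<close> and the normals \<open>u\<close> have the same limit by
  smoothness. But on the direction of \<open>w\<close> the former are nonnegative and the latter at
  most \<open>- \<eta>\<close>.\<close>

lemma smooth_body_uniformly_flat:
  fixes C :: "'a::euclidean_space set"
  assumes C: "smooth_convex_body C" and "\<eta> > 0"
  shows "\<exists>\<tau>>0. \<forall>z u w. z \<in> C \<longrightarrow> norm u = 1 \<longrightarrow> (\<forall>c\<in>C. u \<bullet> c \<le> u \<bullet> z) \<longrightarrow> norm w \<le> \<tau>
     \<longrightarrow> u \<bullet> w \<le> - \<eta> * norm w \<longrightarrow> z + w \<in> C"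
proof (rule ccontr)
  assume no: "\<not> ?thesis"
  have comp: "compact C" and conv: "convex C"
    using C by (simp_all add: smooth_convex_body_def convex_body_def)
  have "\<exists>z u w m. z \<in> C \<and> norm u = 1 \<and> (\<forall>c\<in>C. u \<bullet> c \<le> u \<bullet> z) \<and> norm w \<le> 1 / Suc k
     \<and> u \<bullet> w \<le> - \<eta> * norm w \<and> w \<noteq> 0 \<and> norm m = 1 \<and> (\<forall>c\<in>C. m \<bullet> c \<le> m \<bullet> (z + w))" for k
  proof -
    have "1 / real (Suc k) > 0" by simp
    with no obtain z u w where *: "z \<in> C" "norm u = 1" "\<forall>c\<in>C. u \<bullet> c \<le> u \<bullet> z" "norm w \<le> 1 / Suc k"
      "u \<bullet> w \<le> - \<eta> * norm w" "z + w \<notin> C" by metis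
    then obtain a b where a: "a \<bullet> (z + w) < b" "\<forall>x\<in>C. a \<bullet> x > b"
      using separating_hyperplane_closed_point[OF conv compact_imp_closed[OF comp]] by blast
    then have "a \<noteq> 0" using *(1) by auto
    define m where "m = - (1 / norm a) *\<^sub>R a"
    have "norm m = 1" using \<open>a \<noteq> 0\<close> by (simp add: m_def)
    moreover have "\<forall>c\<in>C. m \<bullet> c \<le> m \<bullet> (z + w)"
      using a \<open>a \<noteq> 0\<close> by (force simp: m_def divide_right_mono simp flip: inner_add_right)
    moreover have "w \<noteq> 0" using * by auto
    ultimately show ?thesis using * by blast
  qed
  then obtain z u w m where S: "\<And>k. z k \<in> C" "\<And>k. norm (u k) = 1"
      "\<And>k c. c \<in> C \<Longrightarrow> u k \<bullet> c \<le> u k \<bullet> z k" "\<And>k::nat. norm (w k) \<le> 1 / Suc k"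
      "\<And>k. u k \<bullet> w k \<le> - \<eta> * norm (w k)" "\<And>k. w k \<noteq> 0" "\<And>k. norm (m k) = 1"
      "\<And>k c. c \<in> C \<Longrightarrow> m k \<bullet> c \<le> m k \<bullet> (z k + w k)"
    by metis
  \<comment> \<open>Normalised, since \<open>w\<close> itself tends to 0 and the contradiction
    concerns its direction.\<close>
  define d where "d k = (1 / norm (w k)) *\<^sub>R w k" for k
  have "compact (C \<times> sphere (0::'a) 1 \<times> sphere (0::'a) 1 \<times> sphere (0::'a) 1)"
    by (intro compact_Times comp compact_sphere)
  moreover have "\<forall>k. (z k, u k, m k, d k) \<in> C \<times> sphere 0 1 \<times> sphere 0 1 \<times> sphere 0 1"
    using S by (simp add: d_def)
  ultimately obtain p r where p: "p \<in> C \<times> sphere 0 1 \<times> sphere 0 1 \<times> sphere 0 1" "strict_mono (r :: nat \<Rightarrow> nat)"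
    "((\<lambda>k. (z k, u k, m k, d k)) \<circ> r) \<longlonglongrightarrow> p"
    unfolding compact_def by meson
  obtain z' u' m' d' where p_eq: "p = (z', u', m', d')" by (metis prod_cases4)
  from p(3) have lim4: "(\<lambda>k. (z (r k), u (r k), m (r k), d (r k))) \<longlonglongrightarrow> (z', u', m', d')"
    by (simp add: p_eq o_def)
  have lim: "(\<lambda>k. z (r k)) \<longlonglongrightarrow> z'" "(\<lambda>k. u (r k)) \<longlonglongrightarrow> u'"
    "(\<lambda>k. m (r k)) \<longlonglongrightarrow> m'" "(\<lambda>k. d (r k)) \<longlonglongrightarrow> d'"
    using tendsto_fst[OF lim4] tendsto_fst[OF tendsto_snd[OF lim4]]
      tendsto_fst[OF tendsto_snd[OF tendsto_snd[OF lim4]]]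
      tendsto_snd[OF tendsto_snd[OF tendsto_snd[OF lim4]]] by simp_all
  have "w \<longlonglongrightarrow> 0"
  proof (rule Lim_null_comparison[OF _ LIMSEQ_Suc[OF lim_1_over_n]])
    show "\<forall>\<^sub>F n in sequentially. norm (w n) \<le> 1 / of_nat (Suc n)" using S(4) by simp
  qed
  then have limw: "(\<lambda>k. w (r k)) \<longlonglongrightarrow> 0" using LIMSEQ_subseq_LIMSEQ[OF _ p(2)] by (auto simp: o_def)
  have u': "u' \<bullet> c \<le> u' \<bullet> z'" if "c \<in> C" for c
    by (rule LIMSEQ_le[OF tendsto_inner[OF lim(2) tendsto_const] tendsto_inner[OF lim(2,1)]])
       (use S(3)[OF that] in blast)
  have m': "m' \<bullet> c \<le> m' \<bullet> z'" if "c \<in> C" for c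
  proof -
    have "m' \<bullet> c \<le> m' \<bullet> (z' + 0)"
      by (rule LIMSEQ_le[OF tendsto_inner[OF lim(3) tendsto_const]
            tendsto_inner[OF lim(3) tendsto_add[OF lim(1) limw]]])
         (use S(8)[OF that] in blast)
    then show ?thesis by simp
  qed
  have "m' = u'" using unique_unit_normal[OF C, of z' u' m'] p(1) u' m' by (auto simp: p_eq)
  have "m (r k) \<bullet> d (r k) \<ge> 0" for k
    using S(8)[OF S(1), of "r k" "r k"] by (simp add: d_def inner_add_right)
  then have "m' \<bullet> d' \<ge> 0" using tendsto_inner[OF lim(3,4)] LIMSEQ_le_const by blast
  moreover have "u (r k) \<bullet> d (r k) \<le> - \<eta>" for k
    using S(5)[of "r k"] S(6)[of "r k"] by (simp add: d_def field_simps)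
  then have "u' \<bullet> d' \<le> - \<eta>" using tendsto_inner[OF lim(2,4)] LIMSEQ_le_const2 by blast
  ultimately show False using \<open>m' = u'\<close> \<open>\<eta> > 0\<close> by simp
qed

text \<open>Division by \<open>l\<close> brings displacements of norm at most \<open>M\<close> below
  \<open>\<tau>\<close>; depth \<open>\<eta>\<close> within distance \<open>M\<close> amounts to
  slope \<open>\<eta> / M\<close>.\<close>

lemma smooth_body_dilate_flat:
  fixes C :: "'a::euclidean_space set"
  assumes C: "smooth_convex_body C" and "\<eta> > 0" "M > 0"
  shows "\<exists>l0>0. \<forall>l\<ge>l0. \<forall>z u y. z \<in> C \<longrightarrow> norm u = 1 \<longrightarrow> (\<forall>c\<in>C. u \<bullet> c \<le> u \<bullet> z)
     \<longrightarrow> norm (y - l *\<^sub>R z) \<le> M \<longrightarrow> u \<bullet> (y - l *\<^sub>R z) \<le> - \<eta> \<longrightarrow> y \<in> (*\<^sub>R) l ` C"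
proof -
  have "\<eta> / M > 0" using assms by simp
  from smooth_body_uniformly_flat[OF C this] obtain \<tau> where \<tau>: "\<tau> > 0"
    "\<And>z u w. z \<in> C \<Longrightarrow> norm u = 1 \<Longrightarrow> (\<forall>c\<in>C. u \<bullet> c \<le> u \<bullet> z) \<Longrightarrow> norm w \<le> \<tau>
     \<Longrightarrow> u \<bullet> w \<le> - (\<eta> / M) * norm w \<Longrightarrow> z + w \<in> C" by metis
  have "y \<in> (*\<^sub>R) l ` C" if l: "l \<ge> M / \<tau>" and z: "z \<in> C" "norm u = 1" "\<forall>c\<in>C. u \<bullet> c \<le> u \<bullet> z"
    and y: "norm (y - l *\<^sub>R z) \<le> M" "u \<bullet> (y - l *\<^sub>R z) \<le> - \<eta>" for l z u y
  proof -
    have "l > 0" using l \<open>M > 0\<close> \<tau>(1) by (meson divide_pos_pos less_le_trans)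
    define w where "w = (1 / l) *\<^sub>R (y - l *\<^sub>R z)"
    have y_eq: "y = l *\<^sub>R (z + w)" using \<open>l > 0\<close> by (simp add: w_def algebra_simps)
    have "norm w \<le> M / l" using y(1) \<open>l > 0\<close> by (simp add: w_def divide_right_mono)
    also have "\<dots> \<le> \<tau>" using l \<open>l > 0\<close> \<tau>(1) by (simp add: field_simps)
    finally have w1: "norm w \<le> \<tau>" .
    have "(\<eta> / M) * norm (y - l *\<^sub>R z) \<le> (\<eta> / M) * M" using y(1) assms by (intro mult_left_mono) auto
    then have "u \<bullet> (y - l *\<^sub>R z) \<le> - (\<eta> / M) * norm (y - l *\<^sub>R z)" using y(2) assms by simp
    from divide_right_mono[OF this, of l] have "u \<bullet> w \<le> - (\<eta> / M) * norm w"
      using \<open>l > 0\<close> by (simp add: w_def)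
    from \<tau>(2)[OF z w1 this] show ?thesis using y_eq by blast
  qed
  moreover have "M / \<tau> > 0" using \<tau> \<open>M > 0\<close> by simp
  ultimately show ?thesis by blast
qed

section \<open>A direction far from orthogonal to all short differences\<close>

lemma countable_isolated_points:
  fixes D :: "'a::second_countable_topology set"
  shows "countable {x\<in>D. \<not> x islimpt D}"
proof -
  obtain B :: "'a set set" where B: "countable B" "topological_basis B"
    using ex_countable_basis by blast
  have "\<exists>b\<in>B. b \<inter> D = {x}" if "x \<in> {x\<in>D. \<not> x islimpt D}" for x
  proof -
    from that obtain T where T: "x \<in> T" "open T" "\<forall>y\<in>D. y \<in> T \<longrightarrow> y = x" "x \<in> D"
      unfolding islimpt_def by auto
    then obtain b where "b \<in> B" "x \<in> b" "b \<subseteq> T" using topological_basisE[OF B(2)] by metis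
    with T show ?thesis by blast
  qed
  then obtain f where f: "\<And>x. x \<in> {x\<in>D. \<not> x islimpt D} \<Longrightarrow> f x \<in> B \<and> f x \<inter> D = {x}" by metis
  then have "inj_on f {x\<in>D. \<not> x islimpt D}" by (intro inj_onI) (metis singleton_inject)
  moreover have "f ` {x\<in>D. \<not> x islimpt D} \<subseteq> B" using f by auto
  ultimately show ?thesis using B(1) countable_image_inj_on countable_subset by metis
qed

text \<open>In the annulus, the closure of \<open>D\<close> consists of finitely many accumulation
  points and countably many isolated points. The hyperplanes orthogonal to them form a null set; a
  direction outside it has a positive minimum of \<open>\<bar>u \<bullet> z\<bar>\<close>, because
  the closure makes \<open>K\<close> compact.\<close>

lemma generic_direction:
  fixes D :: "'a::euclidean_space set"
  assumes fin: "\<And>R. bounded R \<Longrightarrow> finite {p\<in>R. p islimpt D}"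
  shows "\<exists>u \<eta>. norm u = 1 \<and> \<eta> > 0 \<and> (\<forall>z\<in>D. 1 \<le> norm z \<longrightarrow> norm z \<le> M \<longrightarrow> \<eta> \<le> \<bar>u \<bullet> z\<bar>)"
proof -
  define K where "K = closure D \<inter> (cball 0 M - ball 0 1)"
  have "compact K" unfolding K_def
    by (intro closed_Int_compact closed_closure compact_diff) auto
  have "K \<subseteq> {p\<in>cball 0 M. p islimpt D} \<union> {x\<in>D. \<not> x islimpt D}"
    by (auto simp: K_def closure_def)
  then have "countable K"
    by (rule countable_subset[OF _ countable_Un[OF countable_finite[OF fin[OF bounded_cball]]
          countable_isolated_points]])
  have "negligible (\<Union>((\<lambda>z. {x. z \<bullet> x = 0}) ` K))"
  proof (rule negligible_countable_Union)
    show "negligible S" if S: "S \<in> (\<lambda>z. {x. z \<bullet> x = 0}) ` K" for S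
    proof -
      obtain z where z: "z \<in> K" "S = {x. z \<bullet> x = 0}" using S by blast
      have "z \<noteq> 0" using z(1) by (auto simp: K_def)
      then show ?thesis unfolding z(2) by (intro negligible_hyperplane) simp
    qed
  qed (use \<open>countable K\<close> in simp)
  then have "negligible (\<Union>((\<lambda>z. {x. z \<bullet> x = 0}) ` K) \<union> {0})"
    by (intro negligible_Un) auto
  then have "\<Union>((\<lambda>z. {x. z \<bullet> x = 0}) ` K) \<union> {0} \<noteq> UNIV" using non_negligible_UNIV by metis
  then obtain x where x: "x \<noteq> 0" "\<And>z. z \<in> K \<Longrightarrow> z \<bullet> x \<noteq> 0" by blast
  define u where "u = (1 / norm x) *\<^sub>R x"
  have u: "norm u = 1" "\<And>z. z \<in> K \<Longrightarrow> u \<bullet> z \<noteq> 0" using x by (auto simp: u_def inner_commute)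
  have "\<exists>\<eta>>0. \<forall>z\<in>K. \<eta> \<le> \<bar>u \<bullet> z\<bar>"
  proof (cases "K = {}")
    case False
    have "continuous_on K (\<lambda>z. \<bar>u \<bullet> z\<bar>)" by (intro continuous_intros)
    from continuous_attains_inf[OF \<open>compact K\<close> False this] obtain k
      where "k \<in> K" "\<forall>z\<in>K. \<bar>u \<bullet> k\<bar> \<le> \<bar>u \<bullet> z\<bar>" by blast
    then show ?thesis using u(2) by (intro exI[of _ "\<bar>u \<bullet> k\<bar>"]) auto
  qed (auto intro: exI[of _ 1])
  moreover have "z \<in> K" if "z \<in> D" "1 \<le> norm z" "norm z \<le> M" for z
    using that closure_subset by (auto simp: K_def)
  ultimately show ?thesis using u(1) by blast
qed

section \<open>Size of separated sets and density of contacts\<close>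

lemma separated_card_bounded:
  fixes B :: "'a::euclidean_space set"
  assumes "bounded B"
  shows "\<exists>N. \<forall>X\<subseteq>B. (\<forall>x\<in>X. \<forall>y\<in>X. x \<noteq> y \<longrightarrow> norm (x - y) \<ge> 1) \<longrightarrow> card X \<le> N"
proof -
  have "compact (closure B)" using assms by simp
  then obtain k where k: "finite k" "closure B \<subseteq> (\<Union>x\<in>k. ball x (1/2))"
    unfolding compact_eq_totally_bounded by (metis half_gt_zero_iff zero_less_one)
  have "card X \<le> card k" if "X \<subseteq> B" "\<forall>x\<in>X. \<forall>y\<in>X. x \<noteq> y \<longrightarrow> norm (x - y) \<ge> 1" for X
  proof -
    have "\<exists>c\<in>k. dist c x < 1/2" if "x \<in> X" for x
      using k(2) \<open>X \<subseteq> B\<close> that closure_subset[of B] by force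
    then obtain f where f: "\<And>x. x \<in> X \<Longrightarrow> f x \<in> k \<and> dist (f x) x < 1/2" by metis
    have "inj_on f X"
    proof (rule inj_onI, rule ccontr)
      fix x y assume xy: "x \<in> X" "y \<in> X" "f x = f y" "x \<noteq> y"
      then have "dist x y < 1" using f[of x] f[of y] dist_triangle_half_r[of "f x" x 1 y] by simp
      with that xy show False by (force simp: dist_norm)
    qed
    then show ?thesis using f k(1) by (intro card_inj_on_le[of f]) auto
  qed
  then show ?thesis by blast
qed

text \<open>The square of the right-hand side \<open>A + t\<close> exceeds
  \<open>(norm (y - p))\<^sup>2 = A\<^sup>2 + 2 * A * t\<close> by \<open>t\<^sup>2\<close>. This
  serves as a Taylor expansion whose remainder is valid for every step.\<close>

lemma norm_second_order_le:
  fixes p x y :: "'a::real_inner"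
  assumes "x \<noteq> p"
  shows "norm (y - p) \<le> norm (x - p) + (x - p) \<bullet> (y - x) / norm (x - p) + (norm (y - x))\<^sup>2 / (2 * norm (x - p))"
proof -
  define A where "A = norm (x - p)"
  have A: "A > 0" using assms by (simp add: A_def)
  define t where "t = (x - p) \<bullet> (y - x) / A + (norm (y - x))\<^sup>2 / (2 * A)"
  have "(norm (y - p))\<^sup>2 = A\<^sup>2 + 2 * ((x - p) \<bullet> (y - x)) + (norm (y - x))\<^sup>2"
    unfolding A_def power2_norm_eq_inner by (simp add: algebra_simps inner_commute)
  also have "\<dots> = A\<^sup>2 + 2 * A * t" using A by (simp add: t_def field_simps)
  finally have eq: "(norm (y - p))\<^sup>2 = A\<^sup>2 + 2 * A * t" .
  also have "\<dots> \<le> (A + t)\<^sup>2" by (simp add: power2_sum)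
  finally have le: "(norm (y - p))\<^sup>2 \<le> (A + t)\<^sup>2" .
  have "0 \<le> A * (A + 2 * t)" using eq zero_le_power2[of "norm (y - p)"]
    by (simp add: power2_eq_square algebra_simps)
  then have "0 \<le> A + 2 * t" using A by (simp add: zero_le_mult_iff)
  then have "0 \<le> A + t" using A by linarith
  with le have "norm (y - p) \<le> A + t" by (rule power2_le_imp_le)
  then show ?thesis by (simp add: A_def t_def)
qed

text \<open>Condition (ii) of limited complexity for a single packing, with the constant explicit so
  that one \<open>\<rho>\<close> can serve the whole family.\<close>

definition affine_gap :: "real \<Rightarrow> 'a::euclidean_space set \<Rightarrow> bool" where
  "affine_gap \<rho> X \<longleftrightarrow> (\<forall>x\<in>X. \<forall>S. S \<noteq> {} \<and> S \<subseteq> {y\<in>X. norm (x - y) = 1} \<longrightarrow>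
     x \<in> affine hull S \<or> infdist x (affine hull S) > \<rho>)"

text \<open>Translating \<open>x\<close> to the origin turns the condition on affine hulls into the
  gap hypothesis of \<open>polar_cone_perturbation\<close>. In the application \<open>V\<close>
  holds the unprocessed points, the only ones that still touch \<open>x\<close>.\<close>

lemma affine_gap_perturbation:
  fixes X :: "'a::euclidean_space set"
  assumes "affine_gap \<rho> X" "\<rho> > 0" "finite X" "x \<in> X" "V \<subseteq> X" "\<delta> \<ge> 0"
    and le: "\<And>y. y \<in> V \<Longrightarrow> norm (x - y) = 1 \<Longrightarrow> v \<bullet> (y - x) \<le> \<delta>"
  shows "\<exists>v'. norm (v' - v) \<le> \<delta> / \<rho> \<and> (\<forall>y\<in>V. norm (x - y) = 1 \<longrightarrow> v' \<bullet> (y - x) \<le> 0)"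
proof -
  define N where "N = (\<lambda>y. y - x) ` {y\<in>V. norm (x - y) = 1}"
  have "\<exists>v'. norm (v' - v) \<le> \<delta> / \<rho> \<and> (\<forall>y\<in>N. v' \<bullet> y \<le> 0)"
  proof (rule polar_cone_perturbation)
    show "finite N" using assms finite_subset[of V X] by (simp add: N_def)
    show "\<rho> \<le> norm z" if T: "T \<subseteq> N" "0 \<notin> affine hull T" "z \<in> affine hull T" for T z
    proof -
      define S where "S = (+) x ` T"
      have aff: "affine hull S = (+) x ` (affine hull T)"
        unfolding S_def by (rule affine_hull_translation)
      have "S \<noteq> {}" using T(3) by (auto simp: S_def)
      moreover have "S \<subseteq> {y\<in>X. norm (x - y) = 1}" using T(1) \<open>V \<subseteq> X\<close> by (force simp: S_def N_def)
      moreover have "x \<notin> affine hull S" using T(2) by (auto simp: aff)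
      ultimately have "infdist x (affine hull S) > \<rho>" using assms(1,4) by (auto simp: affine_gap_def)
      also have "infdist x (affine hull S) \<le> dist x (x + z)"
        using T(3) by (intro infdist_le) (simp add: aff)
      finally show ?thesis by (simp add: dist_norm)
    qed
  qed (use assms in \<open>auto simp: N_def\<close>)
  then show ?thesis unfolding N_def by blast
qed

text \<open>The constants balance the product of \<open>- \<nabla>g\<close> with an outer normal at
  a contact. The quadratic part contributes at most \<open>- 2 * \<kappa> * r\<close>; the part from
  \<open>p\<close>, at distance at least \<open>L\<close>, and the perturbation each cost at most
  half of \<open>\<kappa> * r\<close>.\<close>

lemma contact_near:
  fixes S :: "'a::euclidean_space set"
  assumes S: "convex S" and U: "finite U" "U \<subseteq> S"
    and sep: "\<And>x y. x \<in> U \<Longrightarrow> y \<in> U \<Longrightarrow> x \<noteq> y \<Longrightarrow> norm (x - y) \<ge> 1"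
    and gap: "affine_gap \<rho> U" "\<rho> > 0"
    and rigid: "\<not> (\<exists>X. finite X \<and> card X = card U \<and> X \<subseteq> interior S \<and>
       (\<forall>x\<in>X. \<forall>y\<in>X. x \<noteq> y \<longrightarrow> norm (x - y) \<ge> 1))"
    and q: "r > 0" "cball q r \<subseteq> S" "S \<subseteq> cball q R"
    and p: "\<And>x. x \<in> S \<Longrightarrow> a \<le> norm (x - p)" "b \<in> S" "norm (b - p) \<le> 2 * a"
    and const: "a > 0" "L > 0" "\<kappa> > 0" "4 * \<kappa> * R \<le> 1" "4 * a \<le> L * \<kappa> * r"
      "2 * (1 / (2 * a) + \<kappa>) \<le> \<rho> * \<kappa> * r" "\<kappa> * r < 1 / 2"
  shows "\<exists>x\<in>U. x \<notin> interior S \<and> norm (x - p) < L"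
proof (rule ccontr)
  assume no: "\<not> ?thesis"
  define \<delta> where "\<delta> = 1 / (2 * a) + \<kappa>"
  have \<delta>: "\<delta> \<ge> 0" "\<delta> / \<rho> \<le> \<kappa> * r / 2" using const \<open>\<rho> > 0\<close> by (simp_all add: \<delta>_def field_simps)
  define g where "g x = norm (x - p) + \<kappa> * (norm (x - q))\<^sup>2" for x
  have "interior (cball q r) \<subseteq> interior S" using q by (intro interior_mono)
  then have "q \<in> interior S" using q(1) by auto
  have step: "\<exists>x\<in>V. \<exists>v. v \<noteq> 0 \<and> x + v \<in> interior S \<and> (\<forall>y\<in>V. norm (x - y) = 1 \<longrightarrow> v \<bullet> (y - x) \<le> 0)"
    if V: "V \<subseteq> U" "V \<noteq> {}" for V
  proof -
    have "finite V" using V U finite_subset by blast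
    then obtain x where x: "x \<in> V" and min: "\<And>y. y \<in> V \<Longrightarrow> g x \<le> g y"
      using ex_is_arg_min_if_finite[of V g] V(2) by (auto simp: is_arg_min_linorder)
    have xS: "x \<in> S" "x \<in> U" using x V U by auto
    define A where "A = norm (x - p)"
    have "a \<le> A" using p(1)[OF xS(1)] by (simp add: A_def)
    with const have A: "a \<le> A" "A > 0" by linarith+
    have "x \<noteq> p" 
    proof
      assume "x = p"
      with A(2) show False by (simp add: A_def)
    qed
    \<comment> \<open>The negative gradient of \<open>g\<close> at \<open>x\<close>. As
      \<open>g\<close> is minimal on \<open>V\<close> at \<open>x\<close>, the product of
      \<open>w\<close> with \<open>y - x\<close> is at most the second-order error
      \<open>\<delta>\<close> of a unit step.\<close>
    define w where "w = - ((1 / A) *\<^sub>R (x - p) + (2 * \<kappa>) *\<^sub>R (x - q))"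
    have w_le: "w \<bullet> (y - x) \<le> \<delta>" if y: "y \<in> V" "norm (x - y) = 1" for y
    proof -
      have n1: "norm (y - x) = 1" using y by (simp add: norm_minus_commute)
      have "norm (y - p) \<le> A + (x - p) \<bullet> (y - x) / A + 1 / (2 * A)"
        using norm_second_order_le[OF \<open>x \<noteq> p\<close>, of y] n1 by (simp add: A_def)
      moreover have "1 / (2 * A) \<le> 1 / (2 * a)" using A const by (simp add: frac_le)
      moreover have eq: "(norm (y - q))\<^sup>2 = (norm (x - q))\<^sup>2 + 2 * ((x - q) \<bullet> (y - x)) + (norm (y - x))\<^sup>2"
        unfolding power2_norm_eq_inner by (simp add: algebra_simps inner_commute)
      have "\<kappa> * (norm (y - q))\<^sup>2 = \<kappa> * (norm (x - q))\<^sup>2 + 2 * \<kappa> * ((x - q) \<bullet> (y - x)) + \<kappa>"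
        unfolding eq n1 by (simp add: distrib_left)
      moreover have "g x \<le> g y" by (rule min[OF y(1)])
      moreover have "w \<bullet> (y - x) = - ((x - p) \<bullet> (y - x) / A) - 2 * \<kappa> * ((x - q) \<bullet> (y - x))"
        unfolding w_def by (simp only: inner_minus_left inner_add_left inner_scaleR_left) simp
      ultimately show ?thesis unfolding g_def \<delta>_def A_def[symmetric] by linarith
    qed
    obtain v where v: "norm (v - w) \<le> \<delta> / \<rho>" "\<forall>y\<in>V. norm (x - y) = 1 \<longrightarrow> v \<bullet> (y - x) \<le> 0"
      using affine_gap_perturbation[OF gap U(1) xS(2) V(1) \<delta>(1) w_le] by blast
    have "v \<noteq> 0"
    proof
      assume "v = 0"
      then have "norm w \<le> \<delta> / \<rho>" using v(1) by simp
      then have "norm w \<le> \<kappa> * r / 2" using \<delta>(2) by (rule order_trans)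
      \<comment> \<open>The part of the gradient from \<open>p\<close> has norm 1, and the quadratic
        part is too short to nearly cancel it.\<close>
      have "1 = norm ((1 / A) *\<^sub>R (x - p))" using A by (simp add: A_def)
      also have "(1 / A) *\<^sub>R (x - p) = - w - (2 * \<kappa>) *\<^sub>R (x - q)" by (simp add: w_def)
      also have "norm \<dots> \<le> norm w + 2 * \<kappa> * norm (x - q)"
        using norm_triangle_ineq4[of "- w" "(2 * \<kappa>) *\<^sub>R (x - q)"] const by simp
      also have "norm (x - q) \<le> R" using xS(1) q(3) by (auto simp: dist_norm norm_minus_commute)
      then have "2 * \<kappa> * norm (x - q) \<le> 2 * \<kappa> * R" using const by (intro mult_left_mono) auto
      finally have "1 \<le> norm w + 2 * \<kappa> * R" by simp
      then show False using \<open>norm w \<le> \<kappa> * r / 2\<close> const by linarith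
    qed
    have "\<exists>e>0. x + e *\<^sub>R v \<in> interior S"
    proof (cases "x \<in> interior S")
      case True
      then obtain d where d: "d > 0" "ball x d \<subseteq> interior S"
        using open_contains_ball[of "interior S"] by auto
      have "x + (d / (2 * norm v)) *\<^sub>R v \<in> ball x d" using d(1) \<open>v \<noteq> 0\<close> by (simp add: dist_norm)
      then show ?thesis using d \<open>v \<noteq> 0\<close> by (intro exI[of _ "d / (2 * norm v)"]) auto
    next
      case False
      then have "L \<le> A" using no xS(2) by (auto simp: A_def not_less)
      show ?thesis
      proof (rule inward_direction[OF S _ xS(1)])
        fix u :: 'a
        assume u: "norm u = 1" and normal: "\<And>s. s \<in> S \<Longrightarrow> u \<bullet> s \<le> u \<bullet> x"
        have "q + r *\<^sub>R u \<in> S" using q u by (auto simp: dist_norm)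
        from normal[OF this] have ux: "u \<bullet> (x - q) \<ge> r"
          using u by (simp add: inner_add_right inner_diff_right dot_square_norm)
        \<comment> \<open>The point \<open>b\<close> of \<open>S\<close> near \<open>p\<close>
          bounds the height of \<open>p\<close> above the supporting hyperplane at
          \<open>x\<close>.\<close>
        have "u \<bullet> (p - b) \<le> norm (b - p)" using norm_cauchy_schwarz[of u "p - b"] u
          by (simp add: norm_minus_commute)
        then have "u \<bullet> (p - x) \<le> 2 * a"
          using normal[OF p(2)] p(3) by (simp add: inner_diff_right)
        then have "u \<bullet> (p - x) / A \<le> 2 * a / A" using A by (intro divide_right_mono) auto
        also have "\<dots> \<le> 2 * a / L" using \<open>L \<le> A\<close> const A by (intro divide_left_mono) auto
        also have "\<dots> \<le> \<kappa> * r / 2" using const by (simp add: field_simps)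
        finally have 1: "u \<bullet> (p - x) / A \<le> \<kappa> * r / 2" .
        have 2: "\<kappa> * r \<le> \<kappa> * (u \<bullet> (x - q))" using ux const by (intro mult_left_mono) auto
        have "u \<bullet> w = u \<bullet> (p - x) / A - 2 * (\<kappa> * (u \<bullet> (x - q)))"
          by (simp add: w_def inner_diff_right inner_add_right diff_divide_distrib algebra_simps)
        moreover have "u \<bullet> (v - w) \<le> norm (v - w)" using norm_cauchy_schwarz[of u "v - w"] u by simp
        ultimately have "u \<bullet> v \<le> \<kappa> * r / 2 - 2 * (\<kappa> * r) + \<kappa> * r / 2"
          using v(1) \<delta>(2) 1 2 inner_diff_right[of u v w] by linarith
        moreover have "\<kappa> * r > 0" using const q(1) by simp
        ultimately show "u \<bullet> v < 0" by linarith
      qed (use \<open>q \<in> interior S\<close> in auto)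
    qed
    then obtain e where e: "e > 0" "x + e *\<^sub>R v \<in> interior S" by blast
    have "\<forall>y\<in>V. norm (x - y) = 1 \<longrightarrow> (e *\<^sub>R v) \<bullet> (y - x) \<le> 0"
      using v(2) e(1) by (simp add: mult_nonneg_nonpos)
    then show ?thesis using x e \<open>v \<noteq> 0\<close> by (intro bexI[of _ x] exI[of _ "e *\<^sub>R v"]) auto
  qed
  have "\<exists>X. finite X \<and> card X = card U + card ({} :: 'a set) \<and> X \<subseteq> interior S \<and>
     (\<forall>x\<in>X. \<forall>y\<in>X. x \<noteq> y \<longrightarrow> norm (x - y) \<ge> 1)"
    by (rule packing_moves_into_interior[OF S U(1) finite.emptyI]) (use U(2) sep step in auto)
  then show False using rigid unfolding card.empty add_0_right by (rule notE[rotated])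
qed

section \<open>Packings that attain the minimum\<close>

lemma affine_gap_translation:
  assumes "affine_gap \<rho> X" shows "affine_gap \<rho> ((+) t ` X)"
  unfolding affine_gap_def
proof (intro ballI allI impI)
  fix x S assume x: "x \<in> (+) t ` X" and S: "S \<noteq> {} \<and> S \<subseteq> {y \<in> (+) t ` X. norm (x - y) = 1}"
  define T where "T = (+) (- t) ` S"
  obtain x' where x': "x' \<in> X" "x = t + x'" using x by blast
  have S_eq: "S = (+) t ` T" by (simp add: T_def image_image)
  have aff: "affine hull S = (+) t ` (affine hull T)" unfolding S_eq by (rule affine_hull_translation)
  have "T \<noteq> {} \<and> T \<subseteq> {y \<in> X. norm (x' - y) = 1}" using S by (force simp: T_def x'(2))
  then have "x' \<in> affine hull T \<or> infdist x' (affine hull T) > \<rho>"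
    using assms x'(1) unfolding affine_gap_def by blast
  moreover have "infdist x (affine hull S) = infdist x' (affine hull T)"
    by (simp add: infdist_def aff x'(2) image_image)
  ultimately show "x \<in> affine hull S \<or> infdist x (affine hull S) > \<rho>"
    by (auto simp: aff x'(2))
qed

text \<open>By \<open>lambda_set_less\<close>, \<open>n\<close> separated points in the interior of
  the inner parallel body would give a smaller dilate, against the minimality of
  \<open>lambda_num\<close>.\<close>

lemma attaining_packing_rigid:
  fixes C :: "'a::euclidean_space set"
  assumes C: "convex_body C" and "n > 0" and att: "attains_lambda C n X"
  defines "l \<equiv> lambda_set C X"
  shows "l > 0 \<and> (\<exists>t. (+) t ` X \<subseteq> inner_parallel ((*\<^sub>R) l ` C)) \<and>
    \<not> (\<exists>Y. finite Y \<and> card Y = n \<and> Y \<subseteq> interior (inner_parallel ((*\<^sub>R) l ` C)) \<and>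
         (\<forall>x\<in>Y. \<forall>y\<in>Y. x \<noteq> y \<longrightarrow> norm (x - y) \<ge> 1))"
proof -
  have X: "finite X" "X \<noteq> {}" using att \<open>n > 0\<close> by (auto simp: attains_lambda_def)
  from lambda_set_is_min(1)[OF C X] have l: "l > 0" "\<exists>t. (+) t ` sphere_packing X \<subseteq> (*\<^sub>R) l ` C"
    by (simp_all add: l_def)
  then have "\<exists>t. (+) t ` X \<subseteq> inner_parallel ((*\<^sub>R) l ` C)"
    unfolding sphere_packing_translate_iff inner_parallel_def by blast
  moreover have False if Y: "finite Y" "card Y = n" "Y \<subseteq> interior (inner_parallel ((*\<^sub>R) l ` C))"
    "\<forall>x\<in>Y. \<forall>y\<in>Y. x \<noteq> y \<longrightarrow> norm (x - y) \<ge> 1" for Y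
  proof -
    have "Y \<noteq> {}" using Y(2) \<open>n > 0\<close> by auto
    then have "lambda_set C Y < l" using lambda_set_less[OF C Y(1) _ l(1) Y(3)] by blast
    moreover have "lambda_num C n \<le> lambda_set C Y"
      using Y by (intro lambda_num_is_min(2)[OF C \<open>n > 0\<close>]) (simp_all add: packing_set_finite_iff)
    ultimately show False using att by (simp add: attains_lambda_def l_def)
  qed
  ultimately show ?thesis using l(1) by blast
qed

text \<open>A dilate by less than \<open>l0\<close> lies in the ball of radius
  \<open>l0 * R\<close>, which has room for only boundedly many separated points.\<close>

lemma attained_lambda_unbounded:
  fixes C :: "'a::euclidean_space set"
  assumes C: "convex_body C"
  shows "\<exists>N>0. \<forall>n\<ge>N. \<forall>X. attains_lambda C n X \<longrightarrow> l0 \<le> lambda_set C X"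
proof -
  have "bounded C" using C by (simp add: convex_body_def compact_imp_bounded)
  then obtain R where R: "R > 0" "\<And>x. x \<in> C \<Longrightarrow> norm x \<le> R" using bounded_pos by blast
  obtain N where N: "\<And>Y. Y \<subseteq> cball (0::'a) (l0 * R) \<Longrightarrow>
      (\<forall>x\<in>Y. \<forall>y\<in>Y. x \<noteq> y \<longrightarrow> norm (x - y) \<ge> 1) \<Longrightarrow> card Y \<le> N"
    using separated_card_bounded[OF bounded_cball] by metis
  have "l0 \<le> lambda_set C X" if n: "n \<ge> Suc N" and att: "attains_lambda C n X" for n X
  proof (rule ccontr)
    assume less: "\<not> l0 \<le> lambda_set C X"
    define l where "l = lambda_set C X"
    obtain t where l: "l > 0" and t: "(+) t ` X \<subseteq> inner_parallel ((*\<^sub>R) l ` C)"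
      using attaining_packing_rigid[OF C _ att] n by (auto simp: l_def)
    have "norm y \<le> l0 * R" if y: "y \<in> (+) t ` X" for y
    proof -
      obtain c where c: "c \<in> C" "y = l *\<^sub>R c" using y t inner_parallel_subset by blast
      then have "norm y = l * norm c" using l by simp
      also have "\<dots> \<le> l0 * R" using less l R(1) R(2)[OF c(1)] by (intro mult_mono) (auto simp: l_def)
      finally show ?thesis .
    qed
    moreover have "\<forall>x\<in>(+) t ` X. \<forall>y\<in>(+) t ` X. x \<noteq> y \<longrightarrow> norm (x - y) \<ge> 1"
      using att by (auto simp: attains_lambda_def packing_set_def)
    ultimately have "card ((+) t ` X) \<le> N" by (intro N) auto
    then show False using att n by (simp add: card_image attains_lambda_def)
  qed
  then show ?thesis by (intro exI[of _ "Suc N"]) auto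
qed

section \<open>Two contacts on a nearly flat piece of the boundary\<close>

text \<open>The ball about a contact stays below the supporting hyperplane. Were the contact too
  deep, the ball of radius \<open>1/2 + \<eta>\<close> about it would lie in the flat region, hence
  in \<open>S\<close>, and the point would be interior to the inner parallel body.\<close>

lemma flat_contact_height:
  fixes S :: "'a::euclidean_space set"
  assumes flat: "\<And>y. norm (y - z) \<le> M \<Longrightarrow> u \<bullet> (y - z) \<le> - \<eta> \<Longrightarrow> y \<in> S"
    and u: "norm u = 1" "\<And>s. s \<in> S \<Longrightarrow> u \<bullet> (s - z) \<le> 0" and "\<eta> > 0"
    and x: "x \<in> inner_parallel S" "x \<notin> interior (inner_parallel S)" "norm (x - z) + 1 / 2 + \<eta> \<le> M"
  shows "- 1 / 2 - 2 * \<eta> < u \<bullet> (x - z) \<and> u \<bullet> (x - z) \<le> - 1 / 2"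
proof
  have "x + (1/2) *\<^sub>R u \<in> S" using x(1) u(1) by (simp add: mem_inner_parallel_iff)
  from u(2)[OF this] show "u \<bullet> (x - z) \<le> - 1 / 2"
    using u(1) by (simp add: inner_diff_right inner_add_right dot_square_norm)
  show "- 1 / 2 - 2 * \<eta> < u \<bullet> (x - z)"
  proof (rule ccontr)
    assume low: "\<not> ?thesis"
    have "cball x (\<eta> + 1/2) \<subseteq> S"
    proof
      fix y assume "y \<in> cball x (\<eta> + 1/2)"
      then have y: "norm (y - x) \<le> \<eta> + 1/2" by (simp add: dist_norm norm_minus_commute)
      have "norm (y - z) \<le> norm (y - x) + norm (x - z)"
        using norm_triangle_ineq[of "y - x" "x - z"] by simp
      then have 1: "norm (y - z) \<le> M" using y x(3) by linarith
      have "u \<bullet> (y - x) \<le> norm (y - x)" using norm_cauchy_schwarz[of u "y - x"] u(1) by simp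
      then have "u \<bullet> (y - z) \<le> - \<eta>" using low y by (simp add: inner_diff_right)
      with 1 show "y \<in> S" by (rule flat)
    qed
    then have "cball x \<eta> \<subseteq> inner_parallel S" by (rule cball_subset_inner_parallel)
    with x(2) \<open>\<eta> > 0\<close> show False by (auto simp: mem_interior_cball)
  qed
qed

lemma isometry_orthogonal:
  assumes "isometry f"
  shows "\<exists>A. orthogonal_transformation A \<and> (\<forall>x y. f x - f y = A (x - y))"
proof (intro exI conjI allI)
  define A where "A x = f x - f 0" for x
  show A: "orthogonal_transformation A"
    using assms by (simp add: orthogonal_transformation_isometry A_def isometry_def dist_norm)
  show "f x - f y = A (x - y)" for x y
    using linear_diff[OF orthogonal_transformation_linear[OF A], of x y] by (simp add: A_def)
qed

theorem theorem2:
  fixes C :: "'a::euclidean_space set" and F :: "'a set set"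
  assumes "DIM('a) \<ge> 2"
    and "smooth_convex_body C"
    and "lc_family F"
  shows "\<exists>n\<^sub>0::nat. \<forall>n\<ge>n\<^sub>0. \<not> (\<exists>X\<in>F. attains_lambda C n X)"
proof -
  have cb: "convex_body C" using assms(2) by (simp add: smooth_convex_body_def)
  then have conv: "convex C" and comp: "compact C" by (simp_all add: convex_body_def)
  have "\<exists>I. (\<forall>X\<in>F. isometry (I X)) \<and> (\<forall>R. bounded R \<longrightarrow>
      finite {p\<in>R. p islimpt {x - y | x y X. X \<in> F \<and> x \<in> I X ` X \<and> y \<in> I X ` X}})"
    using assms(3) unfolding lc_family_def by (elim conjE)
  then obtain I where iso: "\<forall>X\<in>F. isometry (I X)"
    and fin: "\<forall>R. bounded R \<longrightarrow>
      finite {p\<in>R. p islimpt {x - y | x y X. X \<in> F \<and> x \<in> I X ` X \<and> y \<in> I X ` X}}"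
    by (elim exE conjE)
  define D where "D = {x - y | x y X. X \<in> F \<and> x \<in> I X ` X \<and> y \<in> I X ` X}"
  have "\<exists>\<rho>>0. \<forall>X\<in>F. affine_gap \<rho> X"
    using assms(3) unfolding lc_family_def affine_gap_def by (elim conjE)
  then obtain \<rho> where \<rho>: "\<rho> > 0" "\<And>X. X \<in> F \<Longrightarrow> affine_gap \<rho> X" by blast
  obtain q r where q: "r > 0" "cball q r \<subseteq> C"
    using cb unfolding convex_body_def by (meson ex_in_conv mem_interior_cball)
  obtain R where R: "r \<le> R" "C \<subseteq> cball q R"
  proof -
    obtain e where "\<forall>y\<in>C. dist q y \<le> e"
      using compact_imp_bounded[OF comp] unfolding bounded_any_center[of C q] by (elim exE)
    then have "C \<subseteq> cball q (max r e)" by (auto intro: max.coboundedI2)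
    then show ?thesis by (intro that[of "max r e"]) auto
  qed
  \<comment> \<open>The product of the weight \<open>1 / (4 * l * R)\<close> and the radius
    \<open>l * r / 2\<close> passed to \<open>contact_near\<close>. The factor \<open>l\<close>
    cancels, so \<open>a\<close> and \<open>L\<close> do not depend on \<open>n\<close>.\<close>
  define \<theta> where "\<theta> = r / (8 * R)"
  have \<theta>: "0 < \<theta>" "\<theta> \<le> 1 / 8" using q R by (simp_all add: \<theta>_def field_simps)
  \<comment> \<open>Spends half of the perturbation budget \<open>\<rho> * \<theta>\<close>; the
    other half goes to the weight, small for large \<open>l\<close>.\<close>
  define a where "a = max 1 (2 / (\<rho> * \<theta>))"
  have a: "a \<ge> 1" "1 / a \<le> \<rho> * \<theta> / 2"
  proof -
    show "a \<ge> 1" by (simp add: a_def)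
    have "2 / (\<rho> * \<theta>) \<le> a" by (simp add: a_def)
    then show "1 / a \<le> \<rho> * \<theta> / 2" using \<open>a \<ge> 1\<close> \<rho> \<theta> by (simp add: field_simps)
  qed
  define L where "L = 4 * a / \<theta>"
  have L: "L > 0" "4 * a = L * \<theta>" using a \<theta> by (simp_all add: L_def)
  obtain u0 \<eta>0 where u0: "norm u0 = 1" "\<eta>0 > 0"
    "\<And>z. z \<in> D \<Longrightarrow> 1 \<le> norm z \<Longrightarrow> norm z \<le> 4 * L + 1 \<Longrightarrow> \<eta>0 \<le> \<bar>u0 \<bullet> z\<bar>"
    using generic_direction[of D "4 * L + 1"] fin unfolding D_def[symmetric] by blast
  \<comment> \<open>Contact heights will differ by less than \<open>2 * \<eta>\<close>, which must
    not exceed \<open>\<eta>0\<close>; the bound 1/2 serves the point \<open>b\<close>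
    below.\<close>
  define \<eta> where "\<eta> = min (1/2) (\<eta>0 / 2)"
  have \<eta>: "0 < \<eta>" "\<eta> \<le> 1/2" "2 * \<eta> \<le> \<eta>0" using u0 by (simp_all add: \<eta>_def)
  define M where "M = 3 * L + a + 3"
  have "M > 0" using L a by (simp add: M_def)
  from smooth_body_dilate_flat[OF assms(2) \<eta>(1) this] obtain l0 where flat:
    "\<And>l z u y. l0 \<le> l \<Longrightarrow> z \<in> C \<Longrightarrow> norm u = 1 \<Longrightarrow> (\<forall>c\<in>C. u \<bullet> c \<le> u \<bullet> z) \<Longrightarrow>
       norm (y - l *\<^sub>R z) \<le> M \<Longrightarrow> u \<bullet> (y - l *\<^sub>R z) \<le> - \<eta> \<Longrightarrow> y \<in> (*\<^sub>R) l ` C"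
    by metis
  \<comment> \<open>The three bounds serve flatness, the perturbation budget, and a ball of half the
    radius inside the inner parallel body.\<close>
  define l1 where "l1 = max l0 (max (1 / (R * (\<rho> * \<theta>))) (1 / r))"
  obtain N where N: "N > 0" "\<And>n X. n \<ge> N \<Longrightarrow> attains_lambda C n X \<Longrightarrow> l1 \<le> lambda_set C X"
    using attained_lambda_unbounded[OF cb] by metis
  have False if n: "n \<ge> N" and X: "X \<in> F" and att: "attains_lambda C n X" for n X
  proof -
    define l where "l = lambda_set C X"
    have "l1 \<le> l" using N(2)[OF n att] by (simp add: l_def)
    then have l_ge: "l0 \<le> l" "1 / (R * (\<rho> * \<theta>)) \<le> l" "1 / r \<le> l" by (simp_all add: l1_def)
    define S where "S = (*\<^sub>R) l ` C"
    define P where "P = inner_parallel S"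
    have "n > 0" using n N(1) by simp
    from attaining_packing_rigid[OF cb this att] obtain t where "l > 0"
      and t: "(+) t ` X \<subseteq> P"
      and rigid: "\<not> (\<exists>Y. finite Y \<and> card Y = n \<and> Y \<subseteq> interior P \<and>
         (\<forall>x\<in>Y. \<forall>y\<in>Y. x \<noteq> y \<longrightarrow> norm (x - y) \<ge> 1))"
      unfolding l_def[symmetric] S_def[symmetric] P_def[symmetric] by blast
    define U where "U = (+) t ` X"
    have finX: "finite X" and cardX: "card X = n" and packX: "packing_set X"
      using att by (simp_all add: attains_lambda_def)
    have U: "finite U" "U \<subseteq> P" "card U = n" using finX t cardX by (simp_all add: U_def card_image)
    have sep: "norm (x - y) \<ge> 1" if "x \<in> U" "y \<in> U" "x \<noteq> y" for x y
      using that packX by (auto simp: U_def packing_set_def)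
    have gapU: "affine_gap \<rho> U" unfolding U_def by (rule affine_gap_translation[OF \<rho>(2)[OF X]])
    have convS: "convex S" unfolding S_def by (rule convex_scaling[OF conv])
    then have convP: "convex P" unfolding P_def by (rule convex_inner_parallel)
    have scaled_cball: "cball (l *\<^sub>R x) (l * e) = (*\<^sub>R) l ` cball x e" for x :: 'a and e
      using \<open>l > 0\<close> by (simp add: cball_scale)
    have inball: "cball (l *\<^sub>R q) (l * r / 2) \<subseteq> P"
    proof -
      have "l * r / 2 + 1 / 2 \<le> l * r" using l_ge(3) q(1) by (simp add: field_simps)
      then have "cball (l *\<^sub>R q) (l * r / 2 + 1 / 2) \<subseteq> cball (l *\<^sub>R q) (l * r)" by (rule subset_cball)
      also have "\<dots> \<subseteq> S" unfolding scaled_cball S_def using q(2) by (rule image_mono)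
      finally show ?thesis unfolding P_def by (rule cball_subset_inner_parallel)
    qed
    have outball: "P \<subseteq> cball (l *\<^sub>R q) (l * R)"
      unfolding scaled_cball P_def using inner_parallel_subset R(2) by (force simp: S_def)
    obtain A where A: "orthogonal_transformation A" "\<And>x y. I X x - I X y = A (x - y)"
      using isometry_orthogonal[OF bspec[OF iso X]] by blast
    \<comment> \<open>\<open>u0\<close> is generic for the rotated differences, \<open>u\<close> for
      those of \<open>X\<close>. As \<open>u\<close> varies with \<open>X\<close>, flatness had to
      be uniform over the boundary.\<close>
    obtain u where Au: "A u = u0" using orthogonal_transformation_surj[OF A(1)] by (metis surjD)
    have u: "norm u = 1" using orthogonal_transformation_norm[OF A(1), of u] u0(1) Au by simp
    have "continuous_on C (\<lambda>c. u \<bullet> c)" by (intro continuous_intros)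
    moreover have "C \<noteq> {}" using q by auto
    ultimately obtain z where z: "z \<in> C" "\<forall>c\<in>C. u \<bullet> c \<le> u \<bullet> z"
      using continuous_attains_sup[OF comp] by blast
    have flatS: "y \<in> S" if "norm (y - l *\<^sub>R z) \<le> M" "u \<bullet> (y - l *\<^sub>R z) \<le> - \<eta>" for y
      unfolding S_def by (rule flat[OF l_ge(1) z(1) u z(2) that])
    have S_le: "u \<bullet> (s - l *\<^sub>R z) \<le> 0" if "s \<in> S" for s
      using that z(2) \<open>l > 0\<close> by (auto simp: S_def inner_diff_right)
    \<comment> \<open>A tangential direction, available in dimension at least 2, along which
      \<open>p\<close> is displaced.\<close>
    obtain e where e: "norm e = 1" "u \<bullet> e = 0"
    proof -
      obtain y where y: "y \<noteq> 0" "orthogonal u y"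
        using orthogonal_to_vector_exists[OF assms(1)] by blast
      then show ?thesis using that[of "(1 / norm y) *\<^sub>R y"] by (simp add: orthogonal_def)
    qed
    define p where "p s = l *\<^sub>R z + s *\<^sub>R e + a *\<^sub>R u" for s
    have contact: "\<exists>x\<in>U. norm (x - p s) < L \<and> - 1 / 2 - 2 * \<eta> < u \<bullet> (x - l *\<^sub>R z) \<and>
        u \<bullet> (x - l *\<^sub>R z) \<le> - 1 / 2" if s: "0 \<le> s" "s \<le> 2 * L + 1" for s
    proof -
      \<comment> \<open>The ball of radius 1/2 about \<open>b\<close> has depth at least 1/2, so
        flatness puts it into \<open>S\<close>; the distance from \<open>p s\<close> is
        \<open>a + 1\<close>, at most \<open>2 * a\<close>.\<close>
      define b where "b = l *\<^sub>R z + s *\<^sub>R e - u"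
      have "\<exists>x\<in>U. x \<notin> interior P \<and> norm (x - p s) < L"
      proof (rule contact_near[OF convP U(1,2) sep gapU \<rho>(1) _ _ inball outball,
            where a = a and b = b and \<kappa> = "1 / (4 * l * R)"])
        show "\<not> (\<exists>Y. finite Y \<and> card Y = card U \<and> Y \<subseteq> interior P \<and>
            (\<forall>x\<in>Y. \<forall>y\<in>Y. x \<noteq> y \<longrightarrow> norm (x - y) \<ge> 1))" using rigid U(3) by simp
        show "l * r / 2 > 0" using \<open>l > 0\<close> q(1) by simp
        show "a \<le> norm (x - p s)" if "x \<in> P" for x
        proof -
          have "u \<bullet> (x - l *\<^sub>R z) \<le> 0" using S_le that inner_parallel_subset unfolding P_def by blast
          then have "a \<le> u \<bullet> (p s - x)"
            using u e by (simp add: p_def inner_diff_right inner_add_right dot_square_norm)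
          also have "\<dots> \<le> norm (p s - x)" using norm_cauchy_schwarz[of u "p s - x"] u by simp
          finally show ?thesis by (simp add: norm_minus_commute)
        qed
        show "b \<in> P" unfolding P_def mem_inner_parallel_iff
        proof (intro allI impI flatS)
          fix w :: 'a assume w: "norm w \<le> 1 / 2"
          have "norm (b + w - l *\<^sub>R z) = norm (s *\<^sub>R e - u + w)" by (simp add: b_def algebra_simps)
          also have "\<dots> \<le> s + 1 + 1 / 2"
            using norm_triangle_ineq[of "s *\<^sub>R e - u" w] norm_triangle_ineq4[of "s *\<^sub>R e" u] w e u s
            by simp
          also have "\<dots> \<le> M" using s L a by (simp add: M_def)
          finally show "norm (b + w - l *\<^sub>R z) \<le> M" .
          have "u \<bullet> (b + w - l *\<^sub>R z) = u \<bullet> w - 1"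
            using u e by (simp add: b_def inner_diff_right inner_add_right dot_square_norm)
          also have "u \<bullet> w \<le> norm w" using norm_cauchy_schwarz[of u w] u by simp
          finally show "u \<bullet> (b + w - l *\<^sub>R z) \<le> - \<eta>" using w \<eta> by simp
        qed
        have "b - p s = - ((a + 1) *\<^sub>R u)" by (simp add: b_def p_def algebra_simps)
        then show "norm (b - p s) \<le> 2 * a" using u a(1) by simp
        have kr: "1 / (4 * l * R) * (l * r / 2) = \<theta>" using \<open>l > 0\<close> q R by (simp add: \<theta>_def)
        show "a > 0" "L > 0" using a L by simp_all
        show "1 / (4 * l * R) > 0" "4 * (1 / (4 * l * R)) * (l * R) \<le> 1" using \<open>l > 0\<close> q R by simp_all
        show "4 * a \<le> L * (1 / (4 * l * R)) * (l * r / 2)" using L(2) kr by (simp only: mult.assoc)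
        show "1 / (4 * l * R) * (l * r / 2) < 1 / 2" using kr \<theta> by simp
        have "1 / (l * R) \<le> \<rho> * \<theta>" using l_ge(2) \<open>l > 0\<close> q R \<rho> \<theta> by (simp add: field_simps)
        then have "2 * (1 / (2 * a) + 1 / (4 * l * R)) \<le> \<rho> * \<theta>" using a(2) by (simp add: field_simps)
        then show "2 * (1 / (2 * a) + 1 / (4 * l * R)) \<le> \<rho> * (1 / (4 * l * R)) * (l * r / 2)"
          using kr by (simp only: mult.assoc)
      qed
      then obtain x where x: "x \<in> U" "x \<notin> interior P" "norm (x - p s) < L" by blast
      have "norm (x - l *\<^sub>R z) = norm ((x - p s) + (s *\<^sub>R e + a *\<^sub>R u))" by (simp add: p_def)
      also have "\<dots> \<le> norm (x - p s) + norm (s *\<^sub>R e + a *\<^sub>R u)" by (rule norm_triangle_ineq)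
      also have "norm (s *\<^sub>R e + a *\<^sub>R u) \<le> s + a"
        using norm_triangle_ineq[of "s *\<^sub>R e" "a *\<^sub>R u"] e u s a by simp
      finally have "norm (x - l *\<^sub>R z) \<le> norm (x - p s) + (s + a)" by simp
      then have "norm (x - l *\<^sub>R z) + 1 / 2 + \<eta> \<le> M" using x(3) s \<eta> by (simp add: M_def)
      from flat_contact_height[OF flatS u S_le \<eta>(1) _ _ this] x U(2) show ?thesis
        unfolding P_def by blast
    qed
    obtain x1 where x1: "x1 \<in> U" "norm (x1 - p 0) < L" "- 1 / 2 - 2 * \<eta> < u \<bullet> (x1 - l *\<^sub>R z)"
      "u \<bullet> (x1 - l *\<^sub>R z) \<le> - 1 / 2" using contact[of 0] L by auto
    obtain x2 where x2: "x2 \<in> U" "norm (x2 - p (2 * L + 1)) < L"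
      "- 1 / 2 - 2 * \<eta> < u \<bullet> (x2 - l *\<^sub>R z)" "u \<bullet> (x2 - l *\<^sub>R z) \<le> - 1 / 2"
      using contact[of "2 * L + 1"] L by auto
    have np: "norm (p (2 * L + 1) - p 0) = 2 * L + 1" using L e by (simp add: p_def)
    have "norm (x2 - x1) = norm ((x2 - p (2 * L + 1)) + (p (2 * L + 1) - p 0) - (x1 - p 0))" by simp
    also have "\<dots> \<le> norm ((x2 - p (2 * L + 1)) + (p (2 * L + 1) - p 0)) + norm (x1 - p 0)"
      by (rule norm_triangle_ineq4)
    also have "norm ((x2 - p (2 * L + 1)) + (p (2 * L + 1) - p 0)) \<le>
        norm (x2 - p (2 * L + 1)) + norm (p (2 * L + 1) - p 0)" by (rule norm_triangle_ineq)
    finally have "norm (x2 - x1) \<le> 4 * L + 1" using np x1(2) x2(2) by linarith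
    \<comment> \<open>The offset \<open>2 * L + 1\<close> exceeds \<open>2 * L\<close>, so the
      contacts are distinct and thus at least 1 apart.\<close>
    moreover have "x2 \<noteq> x1"
    proof
      assume "x2 = x1"
      then have "norm (p (2 * L + 1) - p 0) = norm ((x1 - p 0) - (x2 - p (2 * L + 1)))" by simp
      then have "norm (p (2 * L + 1) - p 0) < 2 * L"
        using norm_triangle_ineq4[of "x1 - p 0" "x2 - p (2 * L + 1)"] x1(2) x2(2) by linarith
      with np show False by simp
    qed
    then have "1 \<le> norm (x2 - x1)" using sep x1 x2 by blast
    moreover obtain y1 y2 where y: "y1 \<in> X" "y2 \<in> X" "x2 - x1 = y2 - y1"
      using x1(1) x2(1) by (auto simp: U_def)
    have "A (x2 - x1) \<in> D" unfolding D_def y(3) A(2)[symmetric] using X y by blast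
    ultimately have "\<eta>0 \<le> \<bar>u0 \<bullet> A (x2 - x1)\<bar>"
      using u0(3) orthogonal_transformation_norm[OF A(1)] by simp
    moreover have "u0 \<bullet> A (x2 - x1) = u \<bullet> (x2 - x1)"
      unfolding Au[symmetric] using A(1) by (simp add: orthogonal_transformation_def)
    moreover have "u \<bullet> (x2 - x1) = u \<bullet> (x2 - l *\<^sub>R z) - u \<bullet> (x1 - l *\<^sub>R z)"
      by (simp add: inner_diff_right)
    ultimately show False using x1 x2 \<eta> by linarith
  qed
  then show ?thesis by blast
qed

end
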